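(* Let $k$ be a positive integer and let $G$ be a finite, simple, undirected $2k$-regular graph with girth $g(G) \ge 2k$. Then $la(G) \le k+1$.
   Context: The girth $g(G)$ is the length of a shortest cycle in $G$. A linear forest is a graph in which every connected component is a path (a single vertex counts as a path). The linear arboricity $la(G)$ is the minimum number of linear forests whose edge sets partition the edge set $E(G)$. *)

theory Defs
  imports
    "Graph_Theory.Pair_Digraph"
    "Graph_Theory.Digraph_Component"
    "HOL-Library.Extended_Nat"
    "HOL-Library.Disjoint_Sets"
begin

text \<open>
  A finite simple undirected graph is a \<^locale>\<open>pair_graph\<close>: a finite vertex set with a
  symmetric, irreflexive arc set, an undirected edge \<open>uv\<close> being the two arcs
  \<open>(u, v)\<close> and \<open>(v, u)\<close>. The out-degree of a vertex is then its degree.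
\<close>

definition regular_graph :: "nat \<Rightarrow> 'a pair_pre_digraph \<Rightarrow> bool" where
  "regular_graph d G \<longleftrightarrow> (\<forall>v \<in> pverts G. out_degree G v = d)"

text \<open>
  The library's cycles are directed and include back-and-forth walks \<open>(u, v), (v, u)\<close>.
  Those of length at least 3 are the cycles of the undirected graph.
  An acyclic graph has girth \<open>\<infinity>\<close>, as the infimum of the empty set.
\<close>

definition girth :: "'a pair_pre_digraph \<Rightarrow> enat" where
  "girth G = (INF p \<in> {p. pre_digraph.cycle G p \<and> 3 \<le> length p}. enat (length p))"

text \<open>
  Components come out of \<^const>\<open>pre_digraph.max_subgraph\<close> as general digraphs, not pair digraphs.
  The empty arc list gives the path with a single vertex.
\<close>

definition path_graph :: "('a, 'a \<times> 'a) pre_digraph \<Rightarrow> bool" where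
  "path_graph P \<longleftrightarrow> (\<exists>u p v. pre_digraph.apath P u p v \<and>
     verts P = set (pre_digraph.awalk_verts P u p) \<and> arcs P = set p \<union> (set p)\<inverse>)"

definition linear_forest :: "'a pair_pre_digraph \<Rightarrow> bool" where
  "linear_forest F \<longleftrightarrow> pair_graph F \<and>
     (\<forall>C. pre_digraph.max_subgraph F Digraph_Component.connected C \<longrightarrow> path_graph C)"

definition linear_forest_decomposition ::
    "'a pair_pre_digraph \<Rightarrow> nat \<Rightarrow> (nat \<Rightarrow> 'a pair_pre_digraph) \<Rightarrow> bool" where
  "linear_forest_decomposition G m F \<longleftrightarrow>
     (\<forall>i<m. linear_forest (F i) \<and> subgraph (F i) G) \<and>
     disjoint_family_on (\<lambda>i. parcs (F i)) {..<m} \<and>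
     (\<Union>i<m. parcs (F i)) = parcs G"

definition linear_arboricity :: "'a pair_pre_digraph \<Rightarrow> enat" where
  "linear_arboricity G = (INF m \<in> {m. \<exists>F. linear_forest_decomposition G m F}. enat m)"

end

theory Submission
  imports Defs "HOL-Library.Z2"
begin

text \<open>
  Regard edges as two-element vertex sets. By Petersen's theorem they split into \<open>k\<close> classes of
  maximal degree 2. It suffices to find a linear forest \<open>\<sigma>\<close> meeting every cycle of every class:
  then \<open>\<sigma>\<close> and the \<open>k\<close> classes without \<open>\<sigma>\<close> are \<open>k + 1\<close> linear forests.

  Such a \<open>\<sigma>\<close> is a rainbow simplex of the complex of linear forests, whose vertices (the edges of
  the graph) are coloured by the cycle containing them. By the topological version of Hall's theorem
  it exists if for every set \<open>J\<close> of cycles the complex of linear forests in \<open>\<Union>J\<close> has no reduced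
  homology (over the field with two elements) in dimensions below \<open>card J - 1\<close>. All cycles have at
  least \<open>2 * k\<close> edges, so by pigeonhole some class contributes a set \<open>M\<close> of at least \<open>2 * card J\<close>
  edges of \<open>\<Union>J\<close>, with all degrees at most 2. Delete or contract edges one at a time, starting with
  those outside \<open>M\<close>: contracting \<open>m\<close> edges destroys at most \<open>2 * m\<close> edges of \<open>M\<close>, up to a correction
  for vertices that can accept only one of their two \<open>M\<close>-edges. So at least \<open>card M / 2\<close>
  contractions are needed, and the Mayer--Vietoris sequence turns this into the required vanishing.

  Acyclicity is expressed over the field with two elements as well: a set of edges with all degrees
  at most 2 is a linear forest iff it has no nonempty subset with all degrees even.
\<close>

section \<open>Homology modulo 2 and rainbow simplices\<close>

declare add_bit_eq_xor [simp del] mult_bit_eq_and [simp del]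
  bit_not_zero_iff [simp del] bit_not_one_iff [simp del]

lemma bit_add_self [simp]: "(x::bit) + x = 0"
  by (cases x) auto

lemma of_nat_bit: "of_nat n = (if even n then 0 else 1 :: bit)"
  by (induction n) auto

text \<open>The usual simplicial boundary, read off coefficientwise: \<open>\<tau>\<close> collects
  the coefficients of the simplices that have it as a facet. Modulo 2 no signs occur.\<close>

definition boundary :: "'v set \<Rightarrow> ('v set \<Rightarrow> bit) \<Rightarrow> 'v set \<Rightarrow> bit" where
  "boundary V c \<tau> = (\<Sum>x\<in>V - \<tau>. c (insert x \<tau>))"

text \<open>
  The degree \<open>d\<close> of a chain counts vertices, and the empty simplex has degree 0: the homology is
  reduced, and \<open>d\<close> is the dimension plus one.
\<close>

definition chain :: "'v set set \<Rightarrow> nat \<Rightarrow> ('v set \<Rightarrow> bit) \<Rightarrow> bool" where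
  "chain X d c \<longleftrightarrow> (\<forall>\<sigma>. c \<sigma> \<noteq> 0 \<longrightarrow> \<sigma> \<in> X \<and> card \<sigma> = d)"

text \<open>As degrees count vertices, this is the vanishing of reduced homology up to dimension
  \<open>n - 2\<close>. If \<open>{}\<close> is a simplex and \<open>0 < n\<close>, then degree 0
  already forces \<open>X\<close> to have a vertex.\<close>

definition acyclic_below :: "'v set \<Rightarrow> nat \<Rightarrow> 'v set set \<Rightarrow> bool" where
  "acyclic_below V n X \<longleftrightarrow>
     (\<forall>d<n. \<forall>z. chain X d z \<and> boundary V z = (\<lambda>_. 0) \<longrightarrow> (\<exists>b. chain X (Suc d) b \<and> boundary V b = z))"

section \<open>Chain algebra, cones and the Mayer--Vietoris step\<close>

lemma acyclic_belowD:
  assumes "acyclic_below V n X" "d < n" "chain X d z" "boundary V z = (\<lambda>_. 0)"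
  obtains b where "chain X (Suc d) b" "boundary V b = z"
  using assms unfolding acyclic_below_def by blast

lemma acyclic_below_0 [simp]: "acyclic_below V 0 X"
  by (simp add: acyclic_below_def)

lemma boundary_add: "boundary V (\<lambda>\<sigma>. b \<sigma> + c \<sigma>) = (\<lambda>\<tau>. boundary V b \<tau> + boundary V c \<tau>)"
  by (rule ext) (simp only: boundary_def sum.distrib)

lemma boundary_sum: "boundary V (\<lambda>\<sigma>. \<Sum>i\<in>I. c i \<sigma>) = (\<lambda>\<tau>. \<Sum>i\<in>I. boundary V (c i) \<tau>)"
  unfolding boundary_def by (subst sum.swap) simp

text \<open>A cycle is filled by joining the apex \<open>p\<close> to those of its simplices that
  avoid \<open>p\<close>. On faces without \<open>p\<close> the boundary of this join is the given
  cycle by construction; on faces \<open>\<tau>\<close> through \<open>p\<close> it is so because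
  the boundary of the cycle vanishes at \<open>\<tau> - {p}\<close>.\<close>

lemma acyclic_below_cone:
  assumes "finite V" "p \<in> V" "X \<subseteq> Pow V"
    and cone: "\<And>\<sigma>. \<sigma> \<in> X \<Longrightarrow> insert p \<sigma> \<in> X"
  shows "acyclic_below V n X"
  unfolding acyclic_below_def
proof (intro allI impI, elim conjE)
  fix d z assume z: "chain X d z" "boundary V z = (\<lambda>_. 0)"
  let ?b = "\<lambda>\<sigma>. if p \<in> \<sigma> then z (\<sigma> - {p}) else 0"
  have "chain X (Suc d) ?b"
    unfolding chain_def
  proof (intro allI impI)
    fix \<sigma> assume "?b \<sigma> \<noteq> 0"
    then have s: "p \<in> \<sigma>" "z (\<sigma> - {p}) \<noteq> 0" by (auto split: if_splits)
    with z have x: "\<sigma> - {p} \<in> X" "card (\<sigma> - {p}) = d" by (auto simp: chain_def)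
    then have "finite (\<sigma> - {p})" using assms by (auto intro: finite_subset)
    moreover have "\<sigma> \<in> X" using cone[OF x(1)] s by (simp add: insert_absorb)
    ultimately show "\<sigma> \<in> X \<and> card \<sigma> = Suc d" using x s by (metis card_Suc_Diff1 finite_Diff2 finite.emptyI finite_insert)
  qed
  moreover have "boundary V ?b \<tau> = z \<tau>" for \<tau>
  proof (cases "p \<in> \<tau>")
    case False
    have "boundary V ?b \<tau> = (\<Sum>x\<in>V - \<tau>. if x = p then z \<tau> else 0)"
      unfolding boundary_def using False by (intro sum.cong) auto
    then show ?thesis using False assms by simp
  next
    case True
    have "0 = boundary V z (\<tau> - {p})" using z by simp
    also have "\<dots> = z \<tau> + (\<Sum>x\<in>V - \<tau>. z (insert x (\<tau> - {p})))"
    proof -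
      have "V - (\<tau> - {p}) = insert p (V - \<tau>)" using True assms by auto
      then show ?thesis unfolding boundary_def using True assms by (simp add: insert_absorb)
    qed
    also have "(\<Sum>x\<in>V - \<tau>. z (insert x (\<tau> - {p}))) = boundary V ?b \<tau>"
      unfolding boundary_def using True by (intro sum.cong) (auto simp: insert_Diff_if)
    finally show ?thesis by (metis add_right_cancel bit_add_self)
  qed
  ultimately show "\<exists>b. chain X (Suc d) b \<and> boundary V b = z" by blast
qed

text \<open>
  This is the Mayer--Vietoris sequence of \<open>X\<close> as the union of the deletion of \<open>e\<close> and the cone
  over its link.
\<close>

lemma acyclic_below_link_deletion:
  assumes fin: "finite V" and e: "e \<in> V" and sub: "X \<subseteq> Pow V"
    and face: "\<And>\<sigma>. insert e \<sigma> \<in> X \<Longrightarrow> \<sigma> \<in> X"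
    and del: "acyclic_below V n {\<sigma> \<in> X. e \<notin> \<sigma>}"
    and link: "acyclic_below V (n - 1) {\<sigma>. e \<notin> \<sigma> \<and> insert e \<sigma> \<in> X}"
  shows "acyclic_below V n X"
  unfolding acyclic_below_def
proof (intro allI impI, elim conjE)
  fix d z assume dn: "d < n" and z: "chain X d z" "boundary V z = (\<lambda>_. 0)"
  let ?L = "{\<sigma>. e \<notin> \<sigma> \<and> insert e \<sigma> \<in> X}" and ?D = "{\<sigma> \<in> X. e \<notin> \<sigma>}"
  have fins: "finite \<sigma>" if "\<sigma> \<in> X" for \<sigma> using that sub fin by (auto intro: finite_subset)
  have LX: "\<sigma> \<in> X" "finite \<sigma>" if "\<sigma> \<in> ?L" for \<sigma> using that face fins by auto
  \<comment> \<open>The link part of \<open>z\<close>: the chain \<open>z\<close> consists of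
    \<open>e\<close> joined to \<open>?z2\<close> and of simplices avoiding \<open>e\<close>. As
    \<open>z\<close> is a cycle, so is \<open>?z2\<close>.\<close>
  let ?z2 = "\<lambda>\<tau>. if e \<in> \<tau> then 0 else z (insert e \<tau>)"
  have split_e: "V - \<tau> = insert e (V - insert e \<tau>)" if "e \<notin> \<tau>" for \<tau> using that e by auto
  have z2c: "boundary V ?z2 \<tau> = 0" for \<tau>
  proof (cases "e \<in> \<tau>")
    case False
    have "boundary V ?z2 \<tau> = (\<Sum>x\<in>V - insert e \<tau>. ?z2 (insert x \<tau>))"
      unfolding boundary_def using fin by (subst split_e[OF False]) simp
    also have "\<dots> = boundary V z (insert e \<tau>)"
      unfolding boundary_def using False by (intro sum.cong) (auto simp: insert_commute)
    finally show ?thesis using z by simp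
  qed (simp add: boundary_def)
  \<comment> \<open>A filling of \<open>?z2\<close> in the link. For \<open>d = 0\<close> the link
    part would have degree -1; it vanishes and \<open>w = 0\<close> fills it. Otherwise its degree
    is \<open>d - 1\<close>, so acyclicity of the link below \<open>n - 1\<close> suffices.\<close>
  obtain w where w: "chain ?L d w" "boundary V w = ?z2"
  proof (cases d)
    case 0
    have "?z2 \<tau> = 0" for \<tau>
      using z(1) 0 fins[of "insert e \<tau>"] by (auto simp: chain_def)
    then have "?z2 = (\<lambda>_. 0)" by blast
    then show ?thesis
      by (intro that[of "\<lambda>_. 0"]) (simp_all add: chain_def boundary_def fun_eq_iff)
  next
    case (Suc d')
    have "chain ?L d' ?z2"
      unfolding chain_def
    proof (intro allI impI)
      fix \<sigma> assume "?z2 \<sigma> \<noteq> 0"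
      then have "e \<notin> \<sigma>" "insert e \<sigma> \<in> X" "card (insert e \<sigma>) = d"
        using z by (auto simp: chain_def split: if_splits)
      then show "\<sigma> \<in> ?L \<and> card \<sigma> = d'" using fins[of "insert e \<sigma>"] Suc by auto
    qed
    then have ch: "chain ?L d' ?z2" .
    have dn': "d' < n - 1" using dn Suc by simp
    have z2c': "boundary V ?z2 = (\<lambda>_. 0)" using z2c by blast
    show ?thesis
      by (rule acyclic_belowD[OF link dn' ch z2c']) (use that Suc in blast)
  qed
  have we: "w \<sigma> = 0" if "e \<in> \<sigma>" for \<sigma> using w(1) that by (auto simp: chain_def)
  \<comment> \<open>The join of \<open>e\<close> with \<open>w\<close>. Its boundary agrees with
    \<open>z\<close> on all simplices through \<open>e\<close>, so adding that boundary to
    \<open>z\<close> leaves a cycle \<open>?z1\<close> of the deletion, which can be filled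
    there.\<close>
  let ?b1 = "\<lambda>\<sigma>. if e \<in> \<sigma> then w (\<sigma> - {e}) else 0"
  have b1: "chain X (Suc d) ?b1"
    unfolding chain_def
  proof (intro allI impI)
    fix \<sigma> assume "?b1 \<sigma> \<noteq> 0"
    then have s: "e \<in> \<sigma>" "w (\<sigma> - {e}) \<noteq> 0" by (auto split: if_splits)
    with w have x: "insert e (\<sigma> - {e}) \<in> X" "card (\<sigma> - {e}) = d" by (auto simp: chain_def)
    with s have "\<sigma> \<in> X" by (simp add: insert_absorb)
    moreover then have "finite \<sigma>" by (rule fins)
    ultimately show "\<sigma> \<in> X \<and> card \<sigma> = Suc d" using s x card_Suc_Diff1 by metis
  qed
  let ?z1 = "\<lambda>\<tau>. if e \<in> \<tau> then 0 else z \<tau> + w \<tau>"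
  have bdb1: "boundary V ?b1 \<tau> = (if e \<in> \<tau> then z \<tau> else w \<tau>)" for \<tau>
  proof (cases "e \<in> \<tau>")
    case False
    have "boundary V ?b1 \<tau> = (\<Sum>x\<in>V - \<tau>. if x = e then w \<tau> else 0)"
      unfolding boundary_def using False by (intro sum.cong) auto
    then show ?thesis using False fin e by simp
  next
    case True
    have "V - (\<tau> - {e}) = insert e (V - \<tau>)" using True e by auto
    then have "boundary V w (\<tau> - {e}) = (\<Sum>x\<in>V - \<tau>. w (insert x (\<tau> - {e})))"
      unfolding boundary_def using True fin we by simp
    also have "\<dots> = boundary V ?b1 \<tau>"
      unfolding boundary_def using True by (intro sum.cong) (auto simp: insert_Diff_if)
    finally have "boundary V ?b1 \<tau> = ?z2 (\<tau> - {e})" using w(2) by metis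
    then show ?thesis using True by (simp add: insert_absorb)
  qed
  have z1: "chain ?D d ?z1"
    unfolding chain_def
  proof (intro allI impI)
    fix \<sigma> assume "?z1 \<sigma> \<noteq> 0"
    then have "e \<notin> \<sigma>" "z \<sigma> \<noteq> 0 \<or> w \<sigma> \<noteq> 0" by (auto split: if_splits)
    then show "\<sigma> \<in> ?D \<and> card \<sigma> = d" using z(1) w(1) LX(1) unfolding chain_def by blast
  qed
  have bdz1: "boundary V ?z1 = (\<lambda>_. 0)"
  proof
    fix \<tau> show "boundary V ?z1 \<tau> = 0"
    proof (cases "e \<in> \<tau>")
      case False
      have "boundary V ?z1 \<tau> = (\<Sum>x\<in>V - insert e \<tau>. ?z1 (insert x \<tau>))"
        unfolding boundary_def using fin by (subst split_e[OF False]) simp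
      also have "\<dots> = (\<Sum>x\<in>V - insert e \<tau>. z (insert x \<tau>)) + (\<Sum>x\<in>V - insert e \<tau>. w (insert x \<tau>))"
        using False by (subst sum.distrib[symmetric], intro sum.cong) auto
      also have "(\<Sum>x\<in>V - insert e \<tau>. w (insert x \<tau>)) = boundary V w \<tau>"
        unfolding boundary_def using fin we by (subst split_e[OF False]) simp
      also have "boundary V w \<tau> = z (insert e \<tau>)" using w(2) False by simp
      also have "(\<Sum>x\<in>V - insert e \<tau>. z (insert x \<tau>)) + z (insert e \<tau>) = boundary V z \<tau>"
        unfolding boundary_def split_e[OF False] using fin by (simp add: add.commute)
      finally show ?thesis using z by simp
    qed (simp add: boundary_def)
  qed
  obtain b2 where b2: "chain ?D (Suc d) b2" "boundary V b2 = ?z1"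
    by (rule acyclic_belowD[OF del dn z1 bdz1])
  have "chain X (Suc d) (\<lambda>\<sigma>. ?b1 \<sigma> + b2 \<sigma>)"
    unfolding chain_def
  proof (intro allI impI)
    fix \<sigma> assume "?b1 \<sigma> + b2 \<sigma> \<noteq> 0"
    then have "?b1 \<sigma> \<noteq> 0 \<or> b2 \<sigma> \<noteq> 0" by auto
    then show "\<sigma> \<in> X \<and> card \<sigma> = Suc d" using b1 b2(1) unfolding chain_def by blast
  qed
  moreover have "boundary V (\<lambda>\<sigma>. ?b1 \<sigma> + b2 \<sigma>) = z"
  proof
    fix \<tau>
    have "boundary V (\<lambda>\<sigma>. ?b1 \<sigma> + b2 \<sigma>) \<tau> = (if e \<in> \<tau> then z \<tau> else w \<tau>) + ?z1 \<tau>"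
      using bdb1 b2(2) by (simp only: boundary_add)
    then show "boundary V (\<lambda>\<sigma>. ?b1 \<sigma> + b2 \<sigma>) \<tau> = z \<tau>"
      by (cases "e \<in> \<tau>") (simp_all add: add.left_commute[of "w \<tau>"])
  qed
  ultimately show "\<exists>b. chain X (Suc d) b \<and> boundary V b = z" by blast
qed


section \<open>Sperner parity and the topological version of Hall's theorem\<close>

lemma sum_symmetric_bit:
  fixes f :: "'i \<Rightarrow> 'i \<Rightarrow> bit"
  assumes "finite J" "\<And>i j. f i j = f j i"
  shows "(\<Sum>i\<in>J. \<Sum>j\<in>J - {i}. f i j) = 0"
  using assms(1)
proof (induction J)
  case (insert a J)
  have "(\<Sum>i\<in>J. \<Sum>j\<in>insert a J - {i}. f i j) = (\<Sum>i\<in>J. f i a + (\<Sum>j\<in>J - {i}. f i j))"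
  proof (intro sum.cong refl)
    fix i assume "i \<in> J"
    then have "insert a J - {i} = insert a (J - {i})" using insert by auto
    then show "(\<Sum>j\<in>insert a J - {i}. f i j) = f i a + (\<Sum>j\<in>J - {i}. f i j)"
      using insert by simp
  qed
  also have "\<dots> = (\<Sum>i\<in>J. f a i)"
    using insert assms(2)[of _ a] by (simp add: sum.distrib)
  finally show ?case using insert by simp
qed simp

text \<open>
  The parity argument of Sperner's lemma: among the facets of a simplex with colours in \<open>J\<close>, the
  number of those that are rainbow for \<open>J - {i}\<close> is 1 if the simplex is rainbow for \<open>J\<close>, and 0 or 2
  otherwise.
\<close>

lemma sum_boundary_rainbow:
  fixes col :: "'v \<Rightarrow> 'i"
  assumes fin: "finite V" "finite J" and X: "X \<subseteq> Pow V" and i: "i \<in> J"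
    and c: "chain {\<sigma> \<in> X. col ` \<sigma> \<subseteq> J} n c"
  shows "(\<Sum>\<tau> | \<tau> \<in> Pow V \<and> bij_betw col \<tau> (J - {i}). boundary V c \<tau>)
    = (\<Sum>\<sigma> | \<sigma> \<in> Pow V \<and> bij_betw col \<sigma> J. c \<sigma>)"
proof -
  let ?R = "\<lambda>J. {\<tau> \<in> Pow V. bij_betw col \<tau> J}"
  \<comment> \<open>Each pair is a facet with a vertex that completes it. The double sum is
    regrouped by the completed simplex, so \<open>c \<sigma>\<close> gets as weight the number of
    vertices whose removal leaves a facet rainbow for \<open>J - {i}\<close>.\<close>
  let ?S = "SIGMA \<tau>:?R (J - {i}). V - \<tau>"
  let ?g = "\<lambda>(\<tau>, x). insert x \<tau>"
  have finS: "finite ?S" using fin by auto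
  have "(\<Sum>\<tau>\<in>?R (J - {i}). boundary V c \<tau>) = (\<Sum>p\<in>?S. c (?g p))"
    unfolding boundary_def using fin by (subst sum.Sigma) (auto intro!: sum.cong)
  also have "\<dots> = (\<Sum>\<sigma>\<in>Pow V. \<Sum>p | p \<in> ?S \<and> ?g p = \<sigma>. c (?g p))"
    using fin finS by (subst sum.group) auto
  also have "\<dots> = (\<Sum>\<sigma>\<in>Pow V. if bij_betw col \<sigma> J then c \<sigma> else 0)"
  proof (intro sum.cong refl)
    fix \<sigma> assume \<sigma>: "\<sigma> \<in> Pow V"
    let ?F = "{x \<in> \<sigma>. bij_betw col (\<sigma> - {x}) (J - {i})}"
    have "{p \<in> ?S. ?g p = \<sigma>} = (\<lambda>x. (\<sigma> - {x}, x)) ` ?F"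
    proof (intro equalityI subsetI)
      fix p assume "p \<in> {p \<in> ?S. ?g p = \<sigma>}"
      then obtain \<tau> x where p: "p = (\<tau>, x)" "bij_betw col \<tau> (J - {i})" "x \<notin> \<tau>" "insert x \<tau> = \<sigma>"
        by auto
      then have "\<tau> = \<sigma> - {x}" by auto
      with p show "p \<in> (\<lambda>x. (\<sigma> - {x}, x)) ` ?F" by auto
    next
      fix p assume "p \<in> (\<lambda>x. (\<sigma> - {x}, x)) ` ?F"
      then obtain x where x: "x \<in> \<sigma>" "bij_betw col (\<sigma> - {x}) (J - {i})" "p = (\<sigma> - {x}, x)"
        by blast
      then show "p \<in> {p \<in> ?S. ?g p = \<sigma>}" using \<sigma> by auto
    qed
    then have "card {p \<in> ?S. ?g p = \<sigma>} = card ?F"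
      by (simp add: card_image inj_on_def)
    moreover have "(\<Sum>p | p \<in> ?S \<and> ?g p = \<sigma>. c (?g p)) = (\<Sum>p | p \<in> ?S \<and> ?g p = \<sigma>. c \<sigma>)"
      by (intro sum.cong) auto
    ultimately have eq: "(\<Sum>p | p \<in> ?S \<and> ?g p = \<sigma>. c (?g p)) = of_nat (card ?F) * c \<sigma>"
      by simp
    show "(\<Sum>p | p \<in> ?S \<and> ?g p = \<sigma>. c (?g p)) = (if bij_betw col \<sigma> J then c \<sigma> else 0)"
    proof (cases "c \<sigma> = 0")
      case True
      then show ?thesis unfolding eq by simp
    next
      case False
      then have colJ: "col ` \<sigma> \<subseteq> J" using c by (auto simp: chain_def)
      show ?thesis
      proof (cases "bij_betw col \<sigma> J")
        case True
        then obtain x where x: "x \<in> \<sigma>" "col x = i" using i by (auto simp: bij_betw_def)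
        have "?F = {x}"
        proof (intro equalityI subsetI)
          fix y assume y: "y \<in> ?F"
          show "y \<in> {x}"
          proof (rule ccontr)
            assume "y \<notin> {x}"
            then have "x \<in> \<sigma> - {y}" using x by auto
            then show False using y x by (auto simp: bij_betw_def)
          qed
        next
          fix y assume "y \<in> {x}"
          then show "y \<in> ?F" using x True by (auto simp: bij_betw_def inj_on_def)
        qed
        then show ?thesis unfolding eq using True by simp
      next
        case notrb: False
        have "even (card ?F)"
        proof (cases "?F = {}")
          case False
          then obtain x where x: "x \<in> \<sigma>" "bij_betw col (\<sigma> - {x}) (J - {i})" by blast
          have colx: "col x \<in> J" using colJ x by auto
          \<comment> \<open>If \<open>x\<close> had colour \<open>i\<close>, restoring it would make
            \<open>\<sigma>\<close> rainbow for \<open>J\<close>. So its colour recurs at one vertex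
            \<open>y\<close> of the facet, and \<open>x\<close> and \<open>y\<close> are the only
            removable vertices.\<close>
          have "col x \<noteq> i"
          proof
            assume "col x = i"
            moreover have "inj_on col (\<sigma> - {x})" "col ` (\<sigma> - {x}) = J - {i}"
              using x by (simp_all add: bij_betw_def)
            ultimately have "inj_on col (insert x (\<sigma> - {x}))"
                "col ` insert x (\<sigma> - {x}) = insert i (J - {i})"
              unfolding inj_on_insert image_insert by simp_all
            moreover have "insert x (\<sigma> - {x}) = \<sigma>" "insert i (J - {i}) = J" using x i by auto
            ultimately have "bij_betw col \<sigma> J" unfolding bij_betw_def by (simp only: simp_thms)
            then show False using notrb by blast
          qed
          then have "col x \<in> col ` (\<sigma> - {x})" using x colx by (simp add: bij_betw_def)
          then obtain y where "y \<in> \<sigma> - {x}" "col x = col y" by (rule imageE)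
          then have y: "y \<in> \<sigma>" "y \<noteq> x" "col y = col x" by simp_all
          have "?F = {x, y}"
          proof (intro equalityI subsetI)
            fix w assume w: "w \<in> ?F"
            show "w \<in> {x, y}"
            proof (rule ccontr)
              assume "w \<notin> {x, y}"
              then have "x \<in> \<sigma> - {w}" "y \<in> \<sigma> - {w}" using x y by auto
              moreover have "inj_on col (\<sigma> - {w})" using w by (simp add: bij_betw_def)
              ultimately show False using y(2,3) by (auto dest: inj_onD)
            qed
          next
            have "inj_on col (\<sigma> - {y})"
            proof (rule inj_onI)
              fix a b assume ab: "a \<in> \<sigma> - {y}" "b \<in> \<sigma> - {y}" "col a = col b"
              have inj: "inj_on col (\<sigma> - {x})" using x by (simp add: bij_betw_def)
              have key: "c = y" if "c \<in> \<sigma>" "c \<noteq> x" "col c = col x" for c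
                using that y by (intro inj_onD[OF inj]) auto
              show "a = b"
              proof (cases "a = x \<or> b = x")
                case True
                then show ?thesis using ab key[of a] key[of b] by (metis Diff_iff insertI1)
              next
                case False
                then show ?thesis using ab by (intro inj_onD[OF inj]) auto
              qed
            qed
            moreover have "col ` (\<sigma> - {y}) = col ` (\<sigma> - {x})"
            proof -
              have "\<sigma> - {y} = insert x (\<sigma> - {x, y})" "\<sigma> - {x} = insert y (\<sigma> - {x, y})"
                using x y by auto
              then show ?thesis using y(3) by (simp only: image_insert)
            qed
            ultimately have "bij_betw col (\<sigma> - {y}) (J - {i})" using x by (simp add: bij_betw_def)
            then show "w \<in> ?F" if "w \<in> {x, y}" for w using that x y(1) by blast
          qed
          then show ?thesis using y by simp
        next
          case True
          show ?thesis unfolding True by simp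
        qed
        then show ?thesis unfolding eq using notrb by (simp add: of_nat_bit)
      qed
    qed
  qed
  also have "\<dots> = (\<Sum>\<sigma>\<in>?R J. c \<sigma>)"
    using fin by (simp add: sum.If_cases Int_def)
  finally show ?thesis by simp
qed

text \<open>Chains \<open>c J\<close> are built by induction on \<open>card J\<close> such that the
  boundary of \<open>c J\<close> is the sum of the \<open>c (J - {i})\<close>, as for the faces of a
  full simplex on \<open>I\<close>; acyclicity supplies each filling. By the parity argument the
  number of \<open>J\<close>-rainbow simplices in \<open>c J\<close> modulo 2 does not change when a
  colour is added to \<open>J\<close>. It is 1 for \<open>J = {}\<close>, hence also for
  \<open>I\<close>.\<close>

theorem rainbow_simplex:
  fixes col :: "'v \<Rightarrow> 'i"
  assumes fin: "finite V" "finite I" and X: "X \<subseteq> Pow V" "{} \<in> X"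
    and ac: "\<And>J. J \<subseteq> I \<Longrightarrow> acyclic_below V (card J) {\<sigma> \<in> X. col ` \<sigma> \<subseteq> J}"
  shows "\<exists>\<sigma>\<in>X. bij_betw col \<sigma> I"
proof -
  let ?X = "\<lambda>J. {\<sigma> \<in> X. col ` \<sigma> \<subseteq> J}"
  define Q where "Q c J \<longleftrightarrow>
    chain (?X J) (card J) (c J) \<and> boundary V (c J) = (\<lambda>\<tau>. \<Sum>i\<in>J. c (J - {i}) \<tau>)" for c J
  have Qc: "chain (?X J) (card J) (c J)" if "Q c J" for c J using that unfolding Q_def by blast
  have Qb: "boundary V (c J) \<tau> = (\<Sum>i\<in>J. c (J - {i}) \<tau>)" if "Q c J" for c J \<tau>
    using that unfolding Q_def by simp
  \<comment> \<open>The empty simplex starts the construction and fixes the parity at 1.\<close>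
  let ?u = "\<lambda>\<sigma>. if \<sigma> = {} then 1 else (0::bit)"
  have finI: "finite J" if "J \<subseteq> I" for J using that fin(2) by (rule finite_subset)
  have "\<exists>c. c {} = ?u \<and> (\<forall>J\<subseteq>I. card J \<le> n \<longrightarrow> Q c J)" for n
  proof (induction n)
    case 0
    have "chain (?X {}) 0 ?u" "boundary V ?u = (\<lambda>_. 0)" using X by (auto simp: chain_def boundary_def)
    then show ?case using finI by (intro exI[of _ "\<lambda>_. ?u"]) (auto simp: Q_def)
  next
    case (Suc n)
    then obtain c where c: "c {} = ?u" "\<And>J. J \<subseteq> I \<Longrightarrow> card J \<le> n \<Longrightarrow> Q c J" by blast
    let ?B = "\<lambda>J b. chain (?X J) (Suc n) b \<and> boundary V b = (\<lambda>\<tau>. \<Sum>i\<in>J. c (J - {i}) \<tau>)"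
    have "\<exists>b. ?B J b"
      if J: "J \<subseteq> I" "card J = Suc n" for J
    proof -
      let ?z = "\<lambda>\<tau>. \<Sum>i\<in>J. c (J - {i}) \<tau>"
      have finJ: "finite J" using J finI by blast
      have Qi: "Q c (J - {i})" "card (J - {i}) = n" if "i \<in> J" for i
        using c(2)[of "J - {i}"] that J finJ by auto
      have ch: "chain (?X J) n ?z"
        unfolding chain_def
      proof (intro allI impI)
        fix \<sigma> assume "?z \<sigma> \<noteq> 0"
        then obtain i where i: "i \<in> J" "c (J - {i}) \<sigma> \<noteq> 0" by (meson sum.not_neutral_contains_not_neutral)
        then show "\<sigma> \<in> ?X J \<and> card \<sigma> = n" using Qc[OF Qi(1)[OF i(1)]] Qi(2)[OF i(1)] unfolding chain_def by simp blast
      qed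
      have bdz: "boundary V ?z = (\<lambda>_. 0)"
      proof
        fix \<tau>
        have "boundary V ?z \<tau> = (\<Sum>i\<in>J. boundary V (c (J - {i})) \<tau>)" by (simp only: boundary_sum)
        also have "\<dots> = (\<Sum>i\<in>J. \<Sum>j\<in>J - {i}. c (J - {i} - {j}) \<tau>)"
          by (intro sum.cong refl Qb Qi(1))
        \<comment> \<open>Removing \<open>i\<close> and \<open>j\<close> in either order leads to
          the same chain, so the terms cancel in pairs.\<close>
        also have "\<dots> = 0"
        proof (rule sum_symmetric_bit[OF finJ])
          show "c (J - {i} - {j}) \<tau> = c (J - {j} - {i}) \<tau>" for i j
            by (rule arg_cong[where f = "\<lambda>S. c S \<tau>"]) blast
        qed
        finally show "boundary V ?z \<tau> = 0" .
      qed
      have "n < card J" using J(2) by simp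
      then obtain b where "chain (?X J) (Suc n) b" "boundary V b = ?z"
        by (rule acyclic_belowD[OF ac[OF J(1)] _ ch bdz])
      then show ?thesis by (intro exI[of _ b] conjI)
    qed
    then have ex: "\<exists>b. ?B J b" if "J \<subseteq> I" "card J = Suc n" for J using that by blast
    define b where "b J = (SOME b. ?B J b)" for J
    have b: "?B J (b J)" if "J \<subseteq> I" "card J = Suc n" for J
      unfolding b_def using ex[OF that] by (rule someI_ex)
    define c' where "c' J = (if card J = Suc n then b J else c J)" for J
    have "Q c' J" if J: "J \<subseteq> I" "card J \<le> Suc n" for J
    proof -
      have eq: "(\<lambda>\<tau>. \<Sum>i\<in>J. c' (J - {i}) \<tau>) = (\<lambda>\<tau>. \<Sum>i\<in>J. c (J - {i}) \<tau>)"
      proof (intro ext sum.cong refl)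
        fix \<tau> i assume "i \<in> J"
        then have "card (J - {i}) < card J" using finI[OF J(1)] by (rule card_Diff1_less[rotated])
        then show "c' (J - {i}) \<tau> = c (J - {i}) \<tau>" using J by (simp add: c'_def)
      qed
      show ?thesis
      proof (cases "card J = Suc n")
        case True
        then show ?thesis unfolding Q_def eq using b[OF J(1)] by (simp add: c'_def)
      next
        case False
        then have "Q c J" using J c(2) by simp
        then show ?thesis unfolding Q_def eq using False by (simp add: c'_def)
      qed
    qed
    moreover have "c' {} = ?u" using c(1) by (simp add: c'_def)
    ultimately show ?case by blast
  qed
  from this[of "card I"] obtain c where c0: "c {} = ?u" and
    "\<And>J. J \<subseteq> I \<Longrightarrow> card J \<le> card I \<Longrightarrow> Q c J" by blast
  then have c: "Q c J" if "J \<subseteq> I" for J using that card_mono[OF fin(2)] by blast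
  let ?R = "\<lambda>J. {\<tau> \<in> Pow V. bij_betw col \<tau> J}"
  have "(\<Sum>\<sigma>\<in>?R J. c J \<sigma>) = 1" if "J \<subseteq> I" for J
    using finI[OF that] that
  proof (induction J)
    case empty
    have "?R {} = {{}}" by (auto simp: bij_betw_def)
    then show ?case using c0 by simp
  next
    case (insert i J)
    let ?J = "insert i J"
    have JI: "?J \<subseteq> I" "J \<subseteq> I" using insert by auto
    have "(\<Sum>\<sigma>\<in>?R ?J. c ?J \<sigma>) = (\<Sum>\<tau>\<in>?R (?J - {i}). boundary V (c ?J) \<tau>)"
      using sum_boundary_rainbow[OF fin(1) _ X(1), of ?J i col "card ?J" "c ?J"] Qc[OF c[OF JI(1)]] insert by simp
    also have "\<dots> = (\<Sum>\<tau>\<in>?R J. \<Sum>j\<in>?J. c (?J - {j}) \<tau>)"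
      using insert by (intro sum.cong Qb c JI) simp
    \<comment> \<open>Only the face opposite \<open>i\<close> contributes: the simplices of
      \<open>c (?J - {j})\<close> avoid the colour \<open>j\<close>, whereas \<open>\<tau>\<close>
      uses every colour in \<open>J\<close>.\<close>
    also have "\<dots> = (\<Sum>\<tau>\<in>?R J. c J \<tau>)"
    proof (intro sum.cong refl)
      fix \<tau> assume \<tau>: "\<tau> \<in> ?R J"
      have "c (?J - {j}) \<tau> = 0" if "j \<in> J" for j
      proof (rule ccontr)
        assume "c (?J - {j}) \<tau> \<noteq> 0"
        then have "col ` \<tau> \<subseteq> ?J - {j}" using Qc[OF c, of "?J - {j}"] JI unfolding chain_def by blast
        then show False using \<tau> that by (auto simp: bij_betw_def)
      qed
      then have "(\<Sum>j\<in>J. c (?J - {j}) \<tau>) = 0" by (intro sum.neutral) auto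
      then show "(\<Sum>j\<in>?J. c (?J - {j}) \<tau>) = c J \<tau>" using insert by simp
    qed
    finally show ?case using insert JI by simp
  qed
  from this[of I] obtain \<sigma> where "\<sigma> \<in> ?R I" "c I \<sigma> \<noteq> 0"
    by (metis (no_types, lifting) order_refl sum.not_neutral_contains_not_neutral zero_neq_one)
  then show ?thesis using Qc[OF c[OF order_refl]] unfolding chain_def by blast
qed

section \<open>The complex of linear forests\<close>

definition deg :: "'a set set \<Rightarrow> 'a \<Rightarrow> nat" where
  "deg H v = card {e \<in> H. v \<in> e}"

text \<open>The elements of the cycle space over the field with two elements.\<close>

definition even_set :: "'a set set \<Rightarrow> bool" where
  "even_set Z \<longleftrightarrow> (\<forall>v. even (deg Z v))"

definition path_forest :: "'a set set \<Rightarrow> bool" where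
  "path_forest H \<longleftrightarrow> (\<forall>v. deg H v \<le> 2) \<and> (\<forall>Z\<subseteq>H. even_set Z \<longrightarrow> Z = {})"

text \<open>For \<open>F\<close> disjoint from \<open>A\<close> this is the link of \<open>F\<close>
  in the complex of linear forests, restricted to \<open>A\<close>: the edges in \<open>F\<close>
  are contracted, those outside \<open>F \<union> A\<close> deleted.\<close>

definition extensions :: "'a set set \<Rightarrow> 'a set set \<Rightarrow> 'a set set set" where
  "extensions F A = {\<sigma>. \<sigma> \<subseteq> A \<and> path_forest (F \<union> \<sigma>)}"

section \<open>Degrees and even edge sets\<close>

lemma deg_empty [simp]: "deg {} v = 0"
  by (simp add: deg_def)

lemma deg_insert:
  assumes "finite H" "e \<notin> H"
  shows "deg (insert e H) v = deg H v + (if v \<in> e then 1 else 0)"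
proof -
  have "{x \<in> insert e H. v \<in> x} = (if v \<in> e then insert e {x \<in> H. v \<in> x} else {x \<in> H. v \<in> x})"
    by auto
  then show ?thesis using assms by (simp add: deg_def)
qed

lemma deg_mono: "finite H \<Longrightarrow> K \<subseteq> H \<Longrightarrow> deg K v \<le> deg H v"
  unfolding deg_def by (rule card_mono) auto

lemma deg_Un_disjoint:
  assumes "finite H" "finite K" "H \<inter> K = {}"
  shows "deg (H \<union> K) v = deg H v + deg K v"
proof -
  have "{e \<in> H \<union> K. v \<in> e} = {e \<in> H. v \<in> e} \<union> {e \<in> K. v \<in> e}" by auto
  then show ?thesis using assms by (simp add: deg_def card_Un_disjoint disjoint_iff)
qed

lemma deg_pos_iff: "finite H \<Longrightarrow> 0 < deg H v \<longleftrightarrow> v \<in> \<Union>H"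
  by (auto simp: deg_def card_gt_0_iff)

lemma deg_eq_imp_same_star:
  assumes "finite H" "K \<subseteq> H" "deg H v \<le> deg K v"
  shows "{e \<in> K. v \<in> e} = {e \<in> H. v \<in> e}"
  using assms by (intro card_seteq) (auto simp: deg_def)

lemma even_deg_cases:
  assumes "finite H" "K \<subseteq> H" "deg H v \<le> 2" "even (deg K v)"
  obtains "{e \<in> K. v \<in> e} = {}" | "{e \<in> K. v \<in> e} = {e \<in> H. v \<in> e}"
proof (cases "deg K v = 0")
  case True
  have "finite {e \<in> K. v \<in> e}" using finite_subset[OF assms(2,1)] by simp
  then show ?thesis using True that(1) by (simp add: deg_def)
next
  case False
  then have "2 \<le> deg K v" using assms(4) by presburger
  then show ?thesis using assms deg_eq_imp_same_star[of H K v] that(2) by simp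
qed

text \<open>At a vertex of degree at most 2, an even set contains none or all of the edges there.
  This makes even sets closed under intersection, not only under symmetric difference.\<close>

lemma even_deg_Int:
  assumes "finite H" "K \<subseteq> H" "L \<subseteq> H" "deg H v \<le> 2" "even (deg K v)" "even (deg L v)"
  shows "even (deg (K \<inter> L) v)"
proof -
  have eq: "{e \<in> K \<inter> L. v \<in> e} = {e \<in> K. v \<in> e} \<inter> {e \<in> L. v \<in> e}" by auto
  show ?thesis
  proof (rule even_deg_cases[OF assms(1,2,4,5)])
    assume "{e \<in> K. v \<in> e} = {}"
    then have "{e \<in> K \<inter> L. v \<in> e} = {}" unfolding eq by (simp only: Int_empty_left)
    then show ?thesis unfolding deg_def by (simp only: card.empty even_zero)
  next
    assume "{e \<in> K. v \<in> e} = {e \<in> H. v \<in> e}"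
    then have "{e \<in> K \<inter> L. v \<in> e} = {e \<in> L. v \<in> e}" using assms(3) by (auto simp: eq)
    then show ?thesis using assms(6) unfolding deg_def by (simp only:)
  qed
qed

lemma sum_deg:
  assumes "finite Z" "\<And>e. e \<in> Z \<Longrightarrow> card e = 2" "\<Union>Z \<subseteq> U" "finite U"
  shows "(\<Sum>v\<in>U. deg Z v) = 2 * card Z"
proof -
  have "(\<Sum>v\<in>U. deg Z v) = (\<Sum>v\<in>U. \<Sum>e\<in>Z. if v \<in> e then 1 else 0)"
    unfolding deg_def using assms(1) by (simp flip: sum.inter_filter)
  also have "\<dots> = (\<Sum>e\<in>Z. \<Sum>v\<in>U. if v \<in> e then 1 else 0)" by (rule sum.swap)
  also have "\<dots> = (\<Sum>e\<in>Z. 2)"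
  proof (intro sum.cong refl)
    fix e assume e: "e \<in> Z"
    then have "{v \<in> U. v \<in> e} = e" using assms by auto
    then show "(\<Sum>v\<in>U. if v \<in> e then 1 else 0) = (2::nat)"
      using assms(2)[OF e] assms(4) by (simp add: sum.inter_filter[symmetric])
  qed
  finally show ?thesis by simp
qed

text \<open>Handshake parity: the degree sum is even.\<close>

lemma not_single_odd_deg:
  assumes "finite Z" "\<And>e. e \<in> Z \<Longrightarrow> card e = 2" "odd (deg Z w)"
    "\<And>v. v \<noteq> w \<Longrightarrow> even (deg Z v)"
  shows False
proof -
  have "finite e" if "e \<in> Z" for e using assms(2)[OF that] by (simp add: card_ge_0_finite)
  then have fin: "finite (\<Union>Z)" using assms(1) by blast
  have "w \<in> \<Union>Z" unfolding deg_pos_iff[OF assms(1), symmetric] using assms(3) by (rule odd_pos)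
  then have "2 * card Z = deg Z w + (\<Sum>v\<in>\<Union>Z - {w}. deg Z v)"
    using sum_deg[OF assms(1,2), of "\<Union>Z"] fin by (simp add: sum.remove)
  moreover have "even (\<Sum>v\<in>\<Union>Z - {w}. deg Z v)" using assms by (intro dvd_sum) auto
  ultimately have "even (deg Z w)" by (metis dvd_triv_left even_add)
  then show False using assms(3) by simp
qed

lemma path_forest_subset:
  assumes "path_forest H" "finite H" "K \<subseteq> H"
  shows "path_forest K"
  using assms deg_mono[OF assms(2,3)] unfolding path_forest_def by (meson order_trans)

lemma path_forestD:
  assumes "path_forest H"
  shows "deg H v \<le> 2" "Z \<subseteq> H \<Longrightarrow> even_set Z \<Longrightarrow> Z = {}"
  using assms unfolding path_forest_def by blast+

lemma card_2_Int:
  assumes "card e = 2" "card f = 2" "e \<noteq> f" "w \<in> e" "w \<in> f"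
  shows "e \<inter> f = {w}"
proof -
  have fin: "finite e" "finite f" using assms by (simp_all add: card_ge_0_finite)
  have "card (e \<inter> f) \<noteq> 2"
  proof
    assume "card (e \<inter> f) = 2"
    then have "e \<inter> f = e" using card_subset_eq[of e "e \<inter> f"] assms fin by simp
    then have "e \<subseteq> f" by blast
    then have "e = f" using card_subset_eq[of f e] assms fin by simp
    then show False using assms(3) by blast
  qed
  moreover have "card (e \<inter> f) \<le> 2" using assms(1) fin by (metis card_mono inf_le1)
  moreover have "0 < card (e \<inter> f)" using assms fin by (auto simp: card_gt_0_iff)
  ultimately have "card (e \<inter> f) = 1" by linarith
  then obtain u where u: "e \<inter> f = {u}" by (rule card_1_singletonE)
  have "w \<in> e \<inter> f" using assms(4,5) by simp
  then show ?thesis unfolding u by simp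
qed

text \<open>
  The only edge that can close a cycle through a given edge \<open>e\<close> of a linear forest joins the two
  ends of the path containing \<open>e\<close>.
\<close>

lemma closing_edge_unique:
  assumes fin: "finite F" and two: "\<And>g. g \<in> insert f (insert f' F) \<Longrightarrow> card g = 2"
    and F: "path_forest F" and nF: "f \<notin> F" "f' \<notin> F"
    and f: "\<And>v. v \<in> f \<Longrightarrow> deg F v \<le> 1" "Z \<subseteq> insert f F" "even_set Z" "e \<in> Z"
    and f': "\<And>v. v \<in> f' \<Longrightarrow> deg F v \<le> 1" "Z' \<subseteq> insert f' F" "even_set Z'" "e \<in> Z'"
  shows "f = f'"
proof (rule ccontr)
  assume ne: "f \<noteq> f'"
  \<comment> \<open>The parts of the two cycles inside \<open>F\<close>: paths joining the ends of
    \<open>f\<close> and of \<open>f'\<close>, respectively, both through \<open>e\<close>. The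
    contradiction comes from the degrees of their intersection.\<close>
  define P P' where "P = Z - {f}" and "P' = Z' - {f'}"
  have PF: "P \<subseteq> F" "P' \<subseteq> F" using f f' by (auto simp: P_def P'_def)
  have "\<not> Z \<subseteq> F" "\<not> Z' \<subseteq> F" using path_forestD(2)[OF F] f f' by blast+
  then have fZ: "f \<in> Z" "f' \<in> Z'" using f f' by blast+
  have W: "Z \<inter> Z' = P \<inter> P'" using f f' ne nF by (auto simp: P_def P'_def)
  have finP: "finite P" "finite P'" using PF fin finite_subset by blast+
  have "Z = insert f P" "Z' = insert f' P'" "f \<notin> P" "f' \<notin> P'" using fZ by (auto simp: P_def P'_def)
  then have degZ: "deg Z v = deg P v + (if v \<in> f then 1 else 0)"
      "deg Z' v = deg P' v + (if v \<in> f' then 1 else 0)" for v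
    using deg_insert[OF finP(1)] deg_insert[OF finP(2)] by simp_all
  have ev: "even (deg Z v)" "even (deg Z' v)" for v using f f' by (auto simp: even_set_def)
  \<comment> \<open>At an end \<open>v\<close> of just one of the two edges, \<open>F\<close> has
    degree at most 1. The path belonging to the other edge has even degree at \<open>v\<close>,
    hence no edge there.\<close>
  have out: "even (deg (P \<inter> P') v)" if v: "v \<notin> f \<inter> f'" for v
  proof -
    have mono: "deg P v \<le> deg F v" "deg P' v \<le> deg F v"
      "deg (P \<inter> P') v \<le> deg P v" "deg (P \<inter> P') v \<le> deg P' v"
      using PF fin finP by (auto intro: deg_mono)
    consider "v \<notin> f" "v \<notin> f'" | "v \<in> f" "v \<notin> f'" | "v \<notin> f" "v \<in> f'" using v by blast
    then show ?thesis
    proof cases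
      case 1
      then show ?thesis
        using even_deg_Int[OF fin PF] path_forestD(1)[OF F] degZ[of v] ev[of v] by simp
    next
      case 2
      then have "even (deg P' v)" "deg F v \<le> 1" using degZ(2)[of v] ev(2)[of v] f by auto
      then have "deg P' v = 0" using mono by presburger
      then show ?thesis using mono by simp
    next
      case 3
      then have "even (deg P v)" "deg F v \<le> 1" using degZ(1)[of v] ev(1)[of v] f' by auto
      then have "deg P v = 0" using mono by presburger
      then show ?thesis using mono by simp
    qed
  qed
  show False
  proof (cases "f \<inter> f' = {}")
    case True
    then have "even_set (P \<inter> P')" using out by (auto simp: even_set_def)
    then have "P \<inter> P' = {}" using path_forestD(2)[OF F] PF by blast
    then show False using W f f' by blast
  next
    case False
    then obtain w where w: "w \<in> f" "w \<in> f'" by blast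
    \<comment> \<open>At a common end \<open>w\<close> both paths use the single edge of
      \<open>F\<close> there, so \<open>w\<close> would be the only vertex of odd degree in the
      intersection.\<close>
    then have only: "f \<inter> f' = {w}" using two ne by (intro card_2_Int) auto
    have "odd (deg P w)" "odd (deg P' w)" using degZ[of w] ev[of w] w by auto
    then have "deg F w \<le> deg P w" "deg F w \<le> deg P' w"
      using f(1)[OF w(1)] by presburger+
    then have "{g \<in> P. w \<in> g} = {g \<in> F. w \<in> g}" "{g \<in> P'. w \<in> g} = {g \<in> F. w \<in> g}"
      using deg_eq_imp_same_star[OF fin PF(1)] deg_eq_imp_same_star[OF fin PF(2)] by simp_all
    then have "{g \<in> P \<inter> P'. w \<in> g} = {g \<in> P. w \<in> g}" by blast
    then have odd: "odd (deg (P \<inter> P') w)" using \<open>odd (deg P w)\<close> by (simp add: deg_def)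
    show False
    proof (rule not_single_odd_deg[OF _ _ odd])
      show "finite (P \<inter> P')" using finP by simp
      show "card g = 2" if "g \<in> P \<inter> P'" for g using that PF by (intro two) blast
      show "even (deg (P \<inter> P') v)" if "v \<noteq> w" for v using that only by (intro out) simp
    qed
  qed
qed

section \<open>Deletion, contraction and pruning in the complex\<close>

lemma extensions_delete: "{\<sigma> \<in> extensions F A. e \<notin> \<sigma>} = extensions F (A - {e})"
  by (auto simp: extensions_def)

lemma extensions_link:
  "e \<in> A \<Longrightarrow> {\<sigma>. e \<notin> \<sigma> \<and> insert e \<sigma> \<in> extensions F A} = extensions (insert e F) (A - {e})"
  by (auto simp: extensions_def)

text \<open>An edge that cannot be added to \<open>F\<close> on its own lies in no simplex. After a
  contraction this allows the edges that became unusable to be dropped.\<close>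

lemma extensions_alive:
  assumes "finite F" "finite A"
  shows "extensions F A = extensions F {a \<in> A. path_forest (insert a F)}"
proof -
  have "path_forest (insert a F)" if "\<sigma> \<subseteq> A" "path_forest (F \<union> \<sigma>)" "a \<in> \<sigma>" for \<sigma> a
    using that assms by (auto intro!: path_forest_subset[OF that(2)] finite_subset[OF that(1)])
  then show ?thesis by (auto simp: extensions_def)
qed

locale edge_set =
  fixes E :: "'a set set"
  assumes finite_E: "finite E"
    and card_edge: "e \<in> E \<Longrightarrow> card e = 2"
begin

lemma finite_edges: "H \<subseteq> E \<Longrightarrow> finite H"
  using finite_E finite_subset by blast

lemma finite_edge: "e \<in> E \<Longrightarrow> finite e"
  using card_edge[of e] by (simp add: card_ge_0_finite)

lemma finite_Union_edges: "H \<subseteq> E \<Longrightarrow> finite (\<Union>H)"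
  using finite_edges finite_edge by auto

lemma acyclic_extensions_step:
  assumes "F \<subseteq> E" "A \<subseteq> E" "e \<in> A"
    and "acyclic_below E n (extensions F (A - {e}))"
    and "acyclic_below E (n - 1)
      (extensions (insert e F) {a \<in> A - {e}. path_forest (insert a (insert e F))})"
  shows "acyclic_below E n (extensions F A)"
proof (rule acyclic_below_link_deletion[of E e])
  have fin: "finite F" "finite A" using assms finite_edges by auto
  show "finite E" "e \<in> E" "extensions F A \<subseteq> Pow E"
    using assms finite_E by (auto simp: extensions_def)
  show "\<sigma> \<in> extensions F A" if "insert e \<sigma> \<in> extensions F A" for \<sigma>
  proof -
    have sub: "insert e \<sigma> \<subseteq> A" and pf: "path_forest (F \<union> insert e \<sigma>)"
      using that by (simp_all add: extensions_def)
    have "finite (F \<union> insert e \<sigma>)" using fin(1) finite_subset[OF sub fin(2)] by simp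
    then have "path_forest (F \<union> \<sigma>)" by (rule path_forest_subset[OF pf]) blast
    then show ?thesis using sub by (simp add: extensions_def)
  qed
  show "acyclic_below E n {\<sigma> \<in> extensions F A. e \<notin> \<sigma>}"
    using assms by (simp only: extensions_delete)
  show "acyclic_below E (n - 1) {\<sigma>. e \<notin> \<sigma> \<and> insert e \<sigma> \<in> extensions F A}"
    using assms(5) fin extensions_alive[of "insert e F" "A - {e}"]
    by (simp only: extensions_link[OF assms(3)] finite_insert finite_Diff)
qed

lemma acyclic_extensions_cone:
  assumes "F \<subseteq> E" "A \<subseteq> E" "p \<in> A"
    and "\<And>\<sigma>. \<sigma> \<subseteq> A \<Longrightarrow> path_forest (F \<union> \<sigma>) \<Longrightarrow> path_forest (insert p (F \<union> \<sigma>))"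
  shows "acyclic_below E n (extensions F A)"
  using assms finite_E by (intro acyclic_below_cone[of E p]) (auto simp: extensions_def)

lemma deg_insert': "F \<subseteq> E \<Longrightarrow> e \<notin> F \<Longrightarrow> deg (insert e F) v = deg F v + (if v \<in> e then 1 else 0)"
  by (rule deg_insert[OF finite_edges])

lemma finite_deg_pos: "H \<subseteq> E \<Longrightarrow> finite {v. deg H v > 0 \<and> P v}"
  by (rule finite_subset[of _ "\<Union>H"]) (auto simp: finite_Union_edges deg_pos_iff finite_edges)

section \<open>Edges lost when an edge is contracted\<close>

definition conflicts :: "'a set set \<Rightarrow> 'a set set \<Rightarrow> 'a set" where
  "conflicts F R = {v. deg F v = 1 \<and> deg R v = 2}"

lemma finite_conflicts: "F \<subseteq> E \<Longrightarrow> finite (conflicts F R)"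
  using finite_deg_pos[of F "\<lambda>v. deg F v = 1 \<and> deg R v = 2"]
  by (rule finite_subset[rotated]) (auto simp: conflicts_def)

text \<open>The edges that adding \<open>e\<close> to \<open>F\<close> makes unusable through a
  cycle rather than through a degree: each joins the ends of the path containing
  \<open>e\<close>.\<close>

definition closers :: "'a set set \<Rightarrow> 'a set \<Rightarrow> 'a set set" where
  "closers F e = {f \<in> E - insert e F. path_forest (insert f F) \<and>
     (\<forall>v\<in>f. deg (insert e F) v \<le> 1) \<and> (\<exists>Z\<subseteq>insert f (insert e F). even_set Z \<and> Z \<noteq> {})}"

text \<open>Since such an edge can be added to \<open>F\<close> alone, a cycle that it closes in
  \<open>insert e F\<close> passes through \<open>e\<close>. So \<open>closing_edge_unique\<close>
  applies to any two of them.\<close>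

lemma card_closers:
  assumes F: "F \<subseteq> E" "e \<in> E" and pf: "path_forest (insert e F)"
  shows "card (closers F e) \<le> 1"
proof -
  have eq: "f = f'" if f: "f \<in> closers F e" "f' \<in> closers F e" for f f'
  proof -
    have ex: "\<exists>Z\<subseteq>insert g (insert e F). even_set Z \<and> e \<in> Z" if g: "g \<in> closers F e" for g
    proof -
      obtain Z where Z: "Z \<subseteq> insert g (insert e F)" "even_set Z" "Z \<noteq> {}"
        using g unfolding closers_def by blast
      have "path_forest (insert g F)" using g unfolding closers_def by blast
      then have "\<not> Z \<subseteq> insert g F" using path_forestD(2) Z(2,3) by blast
      then have "e \<in> Z" using Z(1) by blast
      then show ?thesis using Z by blast
    qed
    obtain Z where Z: "Z \<subseteq> insert f (insert e F)" "even_set Z" "e \<in> Z" using ex[OF f(1)] by blast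
    obtain Z' where Z': "Z' \<subseteq> insert f' (insert e F)" "even_set Z'" "e \<in> Z'" using ex[OF f(2)] by blast
    show "f = f'"
    proof (rule closing_edge_unique[OF _ _ pf _ _ _ Z _ Z'])
      show "finite (insert e F)" using F finite_edges by simp
      show "card g = 2" if "g \<in> insert f (insert f' (insert e F))" for g
        using that F f by (intro card_edge) (auto simp: closers_def)
    qed (use f in \<open>simp_all add: closers_def\<close>)
  qed
  have "closers F e \<subseteq> {f}" if "f \<in> closers F e" for f using eq[OF that] by blast
  then show ?thesis
    using card_mono[of "{f}" "closers F e" for f] by (cases "closers F e = {}") force+
qed

text \<open>As \<open>e\<close> and \<open>f\<close> can be added separately, adding both can
  overload only a vertex they share, and only if it has degree 1 in \<open>F\<close>. If no vertex
  is overloaded, the failure is a cycle.\<close>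

lemma not_path_forest_insert:
  assumes F: "F \<subseteq> E" and e: "e \<in> E" "e \<notin> F" "path_forest (insert e F)"
    and f: "f \<in> E" "f \<notin> insert e F" "path_forest (insert f F)"
    and bad: "\<not> path_forest (insert f (insert e F))"
  shows "f \<in> closers F e \<or> (\<exists>w\<in>e \<inter> f. deg F w = 1)"
proof (rule disjCI)
  assume none: "\<not> (\<exists>w\<in>e \<inter> f. deg F w = 1)"
  have deg_e: "deg (insert e F) v = deg F v + (if v \<in> e then 1 else 0)" for v
    using F e by (intro deg_insert') auto
  have deg_f: "deg (insert f F) v = deg F v + (if v \<in> f then 1 else 0)" for v
    using F f by (intro deg_insert') auto
  have deg_ef: "deg (insert f (insert e F)) v = deg (insert e F) v + (if v \<in> f then 1 else 0)" for v
    using F e f by (intro deg_insert') auto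
  have two: "deg (insert e F) v \<le> 2" "deg (insert f F) v \<le> 2" for v
    using path_forestD(1)[OF e(3)] path_forestD(1)[OF f(3)] by simp_all
  have le2: "deg (insert f (insert e F)) v \<le> 2" for v
  proof (cases "v \<in> e \<inter> f")
    case True
    then have "deg F v \<noteq> 1" "v \<in> e" "v \<in> f" using none by auto
    then show ?thesis using two[of v] deg_e[of v] deg_f[of v] deg_ef[of v] by simp
  next
    case False
    then show ?thesis using two[of v] deg_e[of v] deg_f[of v] deg_ef[of v] by (auto split: if_splits)
  qed
  then have "\<exists>Z\<subseteq>insert f (insert e F). even_set Z \<and> Z \<noteq> {}"
    using bad unfolding path_forest_def by blast
  moreover have "deg (insert e F) v \<le> 1" if "v \<in> f" for v
    using le2[of v] deg_ef[of v] that by simp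
  ultimately show "f \<in> closers F e" using f unfolding closers_def by blast
qed

text \<open>
  A vertex in \<^const>\<open>conflicts\<close> can absorb only one of its two edges of \<open>R\<close>, so the effective size
  of \<open>R\<close> is \<open>card R - card (conflicts F R)\<close>. Branching on an edge at a conflict (or, without
  conflicts, on an edge of a cycle), contraction lowers this size by at most two, while deletion
  does not lower it (or yields a cone).
\<close>

lemma acyclic_extensions_alive:
  assumes "F \<subseteq> E" "R \<subseteq> E" "F \<inter> R = {}" "\<And>f. f \<in> R \<Longrightarrow> path_forest (insert f F)"
    "\<And>v. deg R v \<le> 2" "2 * n + card (conflicts F R) \<le> card R"
  shows "acyclic_below E n (extensions F R)"
  using assms
proof (induction "card R" arbitrary: F R n rule: less_induct)
  case less
  note F = less.prems(1) and R = less.prems(2) and disj = less.prems(3)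
    and alive = less.prems(4) and degR = less.prems(5) and bound = less.prems(6)
  have finF: "finite F" and finR: "finite R" using F R finite_edges by auto
  have degRF: "deg F v \<le> 1" if "f \<in> R" "v \<in> f" for f v
  proof -
    have "deg (insert f F) v = deg F v + 1" using that F disj by (subst deg_insert') auto
    then show ?thesis using path_forestD(1)[OF alive[OF that(1)], of v] by simp
  qed
  define contr where "contr e = {a \<in> R - {e}. path_forest (insert a (insert e F))}" for e
  have contr: "contr e \<subseteq> R - {e}" for e by (auto simp: contr_def)
  have contract: "acyclic_below E (n - 1) (extensions (insert e F) (contr e))"
    if e: "e \<in> R" and le: "2 * (n - 1) + card (conflicts (insert e F) (contr e)) \<le> card (contr e)" for e
  proof (rule less.hyps[OF _ _ _ _ _ _ le])
    have "contr e \<subset> R" using contr[of e] e by blast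
    then show "card (contr e) < card R" by (rule psubset_card_mono[OF finR])
    show "insert e F \<subseteq> E" "contr e \<subseteq> E" "insert e F \<inter> contr e = {}"
      using e F R disj contr[of e] by auto
    show "path_forest (insert f (insert e F))" if "f \<in> contr e" for f
      using that by (simp add: contr_def)
    show "deg (contr e) v \<le> 2" for v
      using deg_mono[OF finR, of "contr e" v] contr[of e] degR[of v] by fastforce
  qed
  have lost: "f \<in> closers F e \<or> (\<exists>w\<in>e \<inter> f. deg F w = 1)"
    if "e \<in> R" "f \<in> R - {e} - contr e" for e f
    using that F R disj alive by (intro not_path_forest_insert) (auto simp: contr_def)
  have closers1: "card (closers F e) \<le> 1" if "e \<in> R" for e
    using that F R alive by (intro card_closers) auto
  have fin_closers: "finite (closers F e)" for e
    by (rule finite_subset[OF _ finite_E]) (auto simp: closers_def)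
  show ?case
  proof (cases "n = 0")
    case True
    then show ?thesis by simp
  next
    case n: False
    show ?thesis
    proof (cases "conflicts F R = {}")
      case True
      \<comment> \<open>An edge of \<open>R\<close> at \<open>v\<close> forces
        \<open>deg F v \<le> 1\<close>, and then only a conflict could bring the sum of the degrees
        to 3.\<close>
      have degFR: "deg (F \<union> R) v \<le> 2" for v
      proof (cases "deg R v = 0")
        case True
        have "R \<noteq> {}" using bound n by auto
        then obtain f where "f \<in> R" by blast
        then have "deg F v \<le> 2"
          using path_forestD(1)[OF alive, of f v] deg_mono[of "insert f F" F v] finF \<open>f \<in> R\<close>
          by (meson finite_insert order_trans subset_insertI)
        then show ?thesis using True deg_Un_disjoint[OF finF finR disj, of v] by simp
      next
        case False
        then have "{f \<in> R. v \<in> f} \<noteq> {}" unfolding deg_def by (intro notI) simp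
        then obtain f where "f \<in> R" "v \<in> f" by blast
        then have "deg F v \<le> 1" by (rule degRF)
        moreover have "\<not> (deg F v = 1 \<and> deg R v = 2)" using True by (auto simp: conflicts_def)
        ultimately show ?thesis
          using degR[of v] deg_Un_disjoint[OF finF finR disj, of v] by linarith
      qed
      show ?thesis
      proof (cases "path_forest (F \<union> R)")
        \<comment> \<open>Every subset of \<open>R\<close> is a simplex, so any edge of
          \<open>R\<close> is the apex of a cone.\<close>
        case pf: True
        obtain p where p: "p \<in> R" using bound n by fastforce
        show ?thesis
        proof (rule acyclic_extensions_cone[OF F R p])
          fix \<sigma> assume "\<sigma> \<subseteq> R"
          then show "path_forest (insert p (F \<union> \<sigma>))"
            using p finF finR by (intro path_forest_subset[OF pf]) auto
        qed
      next
        case False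
        \<comment> \<open>A smallest nonempty even set \<open>Z\<close> is a cycle. It has two edges
          \<open>e\<close> and \<open>f\<close> in \<open>R\<close>, because each edge of
          \<open>R\<close> can be added to \<open>F\<close> alone without closing a cycle.\<close>
        define P where "P Z \<longleftrightarrow> Z \<subseteq> F \<union> R \<and> even_set Z \<and> Z \<noteq> {}" for Z
        obtain Z0 where "P Z0" using False degFR unfolding path_forest_def P_def by blast
        then obtain Z where "P Z \<and> (\<forall>Z'. P Z' \<longrightarrow> card Z \<le> card Z')"
          using ex_has_least_nat[of P Z0 card] by blast
        then have Z: "Z \<subseteq> F \<union> R" "even_set Z" "Z \<noteq> {}"
          and min: "\<And>Z'. Z' \<subseteq> F \<union> R \<Longrightarrow> even_set Z' \<Longrightarrow> Z' \<noteq> {} \<Longrightarrow> card Z \<le> card Z'"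
          unfolding P_def by simp_all
        have finZ: "finite Z" by (rule finite_subset[OF Z(1)]) (simp add: finF finR)
        have nsub: "\<not> Z \<subseteq> insert f F" if "f \<in> R" for f
          using path_forestD(2)[OF alive[OF that] _ Z(2)] Z(3) by blast
        obtain r where "r \<in> R" using bound n by fastforce
        then have "\<not> Z \<subseteq> F" using nsub[of r] by blast
        then obtain e where e: "e \<in> Z" "e \<in> R" using Z(1) by blast
        obtain f where f: "f \<in> Z" "f \<in> R" "f \<noteq> e" using nsub[OF e(2)] Z(1) by blast
        \<comment> \<open>Once \<open>e\<close> is deleted, \<open>f\<close> is an apex: an even set
          \<open>Z'\<close> containing \<open>f\<close> meets \<open>Z\<close> in a nonempty even
          set, so by minimality it contains all of \<open>Z\<close>, including
          \<open>e\<close>.\<close>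
        have "acyclic_below E n (extensions F (R - {e}))"
        proof (rule acyclic_extensions_cone[OF F])
          show "R - {e} \<subseteq> E" "f \<in> R - {e}" using R f by auto
          fix \<sigma> assume \<sigma>: "\<sigma> \<subseteq> R - {e}" and pf: "path_forest (F \<union> \<sigma>)"
          have sub: "insert f (F \<union> \<sigma>) \<subseteq> F \<union> R" using \<sigma> f by blast
          have finFR: "finite (F \<union> R)" using finF finR by simp
          show "path_forest (insert f (F \<union> \<sigma>))"
            unfolding path_forest_def
          proof (intro conjI allI impI)
            show "deg (insert f (F \<union> \<sigma>)) v \<le> 2" for v
              using deg_mono[OF finFR sub, of v] degFR[of v] by linarith
            fix Z' assume Z': "Z' \<subseteq> insert f (F \<union> \<sigma>)" "even_set Z'"
            have Z'FR: "Z' \<subseteq> F \<union> R" using Z'(1) sub by blast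
            show "Z' = {}"
            proof (rule ccontr)
              assume ne: "Z' \<noteq> {}"
              have "f \<in> Z'" using path_forestD(2)[OF pf _ Z'(2)] Z'(1) ne by blast
              have "even_set (Z \<inter> Z')"
                using even_deg_Int[OF finFR Z(1) Z'FR degFR] Z(2) Z'(2) by (simp add: even_set_def)
              then have "card Z \<le> card (Z \<inter> Z')"
                using min[of "Z \<inter> Z'"] Z(1) f(1) \<open>f \<in> Z'\<close> by blast
              then have "Z \<inter> Z' = Z" using finZ by (intro card_seteq) auto
              moreover have "e \<notin> Z'" using Z'(1) \<sigma> e f disj by auto
              ultimately show False using e by blast
            qed
          qed
        qed
        moreover have "acyclic_below E (n - 1) (extensions (insert e F) (contr e))"
        proof (rule contract[OF e(2)])
          \<comment> \<open>Two edges of \<open>R\<close> sharing a vertex of degree 1 in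
            \<open>F\<close> would create a conflict. So apart from \<open>e\<close> only a closer
            is lost, at most one edge.\<close>
          have "R - {e} - contr e \<subseteq> closers F e"
          proof
            fix g assume g: "g \<in> R - {e} - contr e"
            have "deg F w \<noteq> 1" if w: "w \<in> e \<inter> g" for w
            proof
              assume F1: "deg F w = 1"
              have "{e, g} \<subseteq> R" using e g by auto
              then have "deg {e, g} w \<le> deg R w" by (rule deg_mono[OF finR])
              moreover have "{x \<in> {e, g}. w \<in> x} = {e, g}" using w by auto
              then have "deg {e, g} w = 2" using g unfolding deg_def by (simp only: card_2_iff) blast
              ultimately show False
                using F1 degFR[of w] deg_Un_disjoint[OF finF finR disj, of w] by linarith
            qed
            then show "g \<in> closers F e" using lost[OF e(2) g] by blast
          qed
          then have "card (R - {e} - contr e) \<le> 1"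
            using closers1[OF e(2)] card_mono[OF fin_closers] by (meson order_trans)
          moreover have "card (R - {e} - contr e) = card R - 1 - card (contr e)"
            using contr[of e] e finR by (subst card_Diff_subset) (auto intro: finite_subset)
          ultimately have "card R \<le> card (contr e) + 2" by linarith
          moreover have "conflicts (insert e F) (contr e) = {}"
          proof -
            have "deg (insert e F) v + deg (contr e) v \<le> 2" for v
            proof -
              have "deg (insert e F) v + deg (contr e) v = deg (insert e F \<union> contr e) v"
                using finF finR contr[of e] disj
                by (subst deg_Un_disjoint) (auto intro: finite_subset)
              also have "\<dots> \<le> deg (F \<union> R) v"
                using finF finR contr[of e] e by (intro deg_mono) auto
              finally show ?thesis using degFR[of v] by linarith
            qed
            then have "\<not> (deg (insert e F) v = 1 \<and> deg (contr e) v = 2)" for v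
              by (metis add.commute not_less_eq_eq numeral_2_eq_2 order_refl plus_1_eq_Suc)
            then show ?thesis unfolding conflicts_def by blast
          qed
          ultimately show "2 * (n - 1) + card (conflicts (insert e F) (contr e)) \<le> card (contr e)"
            using bound n by simp
        qed
        ultimately show ?thesis
          using acyclic_extensions_step[OF F R e(2)] unfolding contr_def by blast
      qed
    next
      case False
      then obtain a where a: "a \<in> conflicts F R" by blast
      then have dega: "deg F a = 1" "deg R a = 2" by (auto simp: conflicts_def)
      then have "{f \<in> R. a \<in> f} \<noteq> {}" unfolding deg_def by (intro notI) simp
      then obtain e where e: "e \<in> R" "a \<in> e" by blast
      have "card e = 2" using e R card_edge by blast
      then obtain v where v: "e = {a, v}" "v \<noteq> a"
        using e(2) by (auto simp: card_2_iff)
      have finQ: "finite (conflicts F R)" using F by (rule finite_conflicts)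
      \<comment> \<open>Deletion costs one edge but also removes the conflict at \<open>a\<close>,
        so the bound persists with the same \<open>n\<close>.\<close>
      have "acyclic_below E n (extensions F (R - {e}))"
      proof (rule less.hyps)
        show "card (R - {e}) < card R" using e finR by (intro card_Diff1_less)
        show "F \<subseteq> E" "R - {e} \<subseteq> E" "F \<inter> (R - {e}) = {}" using F R disj by auto
        show "path_forest (insert f F)" if "f \<in> R - {e}" for f using that alive by blast
        have degle: "deg (R - {e}) w \<le> deg R w" for w by (rule deg_mono[OF finR]) blast
        then show "deg (R - {e}) w \<le> 2" for w using degR[of w] by (rule order_trans)
        have degRe: "deg R w = deg (R - {e}) w + (if w \<in> e then 1 else 0)" for w
          using deg_insert[of "R - {e}" e w] finR e by (simp add: insert_absorb)
        have "conflicts F (R - {e}) \<subseteq> conflicts F R - {a}"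
        proof
          fix w assume w: "w \<in> conflicts F (R - {e})"
          then have "deg R w = 2" "deg F w = 1" "deg (R - {e}) w = 2"
            using degle[of w] degR[of w] by (auto simp: conflicts_def)
          moreover have "deg (R - {e}) a \<noteq> 2" using degRe[of a] dega e by simp
          ultimately show "w \<in> conflicts F R - {a}" by (auto simp: conflicts_def)
        qed
        then have "card (conflicts F (R - {e})) \<le> card (conflicts F R - {a})"
          using finQ by (intro card_mono) auto
        also have "\<dots> = card (conflicts F R) - 1" using a by simp
        finally have "card (conflicts F (R - {e})) \<le> card (conflicts F R) - 1" .
        moreover have "0 < card (conflicts F R)" using a finQ by (auto simp: card_gt_0_iff)
        moreover have "card (R - {e}) = card R - 1" using e by simp
        ultimately show "2 * n + card (conflicts F (R - {e})) \<le> card (R - {e})"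
          using bound by linarith
      qed
      moreover have "acyclic_below E (n - 1) (extensions (insert e F) (contr e))"
      proof (rule contract[OF e(1)])
        let ?S = "\<lambda>w. {g \<in> R. w \<in> g}"
        have deg_e: "deg (insert e F) w = deg F w + (if w \<in> e then 1 else 0)" for w
          using F e disj by (intro deg_insert') auto
        have degc: "deg (contr e) w \<le> deg (R - {e}) w" for w
          using finR contr[of e] by (intro deg_mono) auto
        have degRe: "deg R w = deg (R - {e}) w + (if w \<in> e then 1 else 0)" for w
          using deg_insert[of "R - {e}" e w] finR e by (simp add: insert_absorb)
        \<comment> \<open>At the ends of \<open>e\<close> at most one other edge of \<open>R\<close>
          remains, so neither is a conflict any more; elsewhere the degrees in \<open>F\<close> are
          unchanged.\<close>
        have Q': "conflicts (insert e F) (contr e) \<subseteq> conflicts F R - {a, v}"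
        proof
          fix w assume "w \<in> conflicts (insert e F) (contr e)"
          then have w: "deg (insert e F) w = 1" "deg (contr e) w = 2" by (auto simp: conflicts_def)
          have "w \<notin> e"
            using w degc[of w] degRe[of w] degR[of w] by (intro notI) simp
          then have "deg F w = 1" "deg R w = 2"
            using w deg_e[of w] degc[of w] degRe[of w] degR[of w] by auto
          then show "w \<in> conflicts F R - {a, v}"
            using \<open>w \<notin> e\<close> v by (auto simp: conflicts_def)
        qed
        then have cardQ': "card (conflicts (insert e F) (contr e)) \<le> card (conflicts F R - {a, v})"
          using finQ by (intro card_mono) auto
        \<comment> \<open>Apart from a closer, an edge is lost only at an end of \<open>e\<close>
          that has degree 1 in \<open>F\<close>: at \<open>a\<close>, and possibly at
          \<open>v\<close>.\<close>
        have cont: "R - contr e \<subseteq> ?S a \<union> (if deg F v = 1 then ?S v else {}) \<union> closers F e"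
        proof
          fix g assume g: "g \<in> R - contr e"
          show "g \<in> ?S a \<union> (if deg F v = 1 then ?S v else {}) \<union> closers F e"
          proof (cases "g = e")
            case True
            then show ?thesis using e by simp
          next
            case False
            then have "g \<in> closers F e \<or> (\<exists>w\<in>e \<inter> g. deg F w = 1)" using g by (intro lost e) simp
            then show ?thesis using g v by auto
          qed
        qed
        have Sa: "card (?S a) = 2" using dega by (simp add: deg_def)
        have finS: "finite (?S w)" for w using finR by simp
        have split_card: "card R \<le> card (R - contr e) + card (contr e)"
          using finR contr[of e] by (subst card_Diff_subset) (auto intro: finite_subset)
        show "2 * (n - 1) + card (conflicts (insert e F) (contr e)) \<le> card (contr e)"
        \<comment> \<open>If \<open>v\<close> is a conflict too, at most 3 + 1 edges are lost along
          with two conflicts. Otherwise, if \<open>deg F v = 1\<close>, the only edge of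
          \<open>R\<close> at \<open>v\<close> is \<open>e\<close>, so at most 2 + 1 edges are lost
          along with at least one conflict. Either way the effective size drops by at most
          two.\<close>
        proof (cases "v \<in> conflicts F R")
          case True
          then have "card (?S v) = 2" "deg F v = 1" by (simp_all add: conflicts_def deg_def)
          have "?S a \<union> ?S v = insert e (?S a - {e} \<union> (?S v - {e}))" using e v by auto
          then have "card (?S a \<union> ?S v) \<le> Suc (card (?S a - {e} \<union> (?S v - {e})))"
            using finS by (simp add: card_insert_if)
          also have "card (?S a - {e} \<union> (?S v - {e})) \<le> card (?S a - {e}) + card (?S v - {e})"
            by (rule card_Un_le)
          also have "card (?S a - {e}) = 1" using Sa e by simp
          also have "card (?S v - {e}) = 1" using \<open>card (?S v) = 2\<close> e v by simp
          finally have "card (?S a \<union> ?S v) \<le> 3" by simp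
          moreover have "card (R - contr e) \<le> card (?S a \<union> ?S v \<union> closers F e)"
            using cont \<open>deg F v = 1\<close> finS fin_closers by (intro card_mono) simp_all
          ultimately have "card (R - contr e) \<le> 4"
            using card_Un_le[of "?S a \<union> ?S v" "closers F e"] closers1[OF e(1)] by linarith
          moreover have "card (conflicts F R - {a, v}) = card (conflicts F R) - 2"
            using True a v by (subst card_Diff_subset) auto
          moreover have "2 \<le> card (conflicts F R)"
            using card_mono[OF finQ, of "{a, v}"] True a v by simp
          ultimately show ?thesis using cardQ' split_card bound n by linarith
        next
          case False
          have "(if deg F v = 1 then ?S v else {}) \<subseteq> ?S a"
          proof (cases "deg F v = 1")
            case True
            then have "deg R v \<noteq> 2" using False by (simp add: conflicts_def)
            then have "card (?S v) \<le> card {e}" using degR[of v] by (simp add: deg_def)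
            moreover have "{e} \<subseteq> ?S v" using e v by simp
            ultimately have "{e} = ?S v" using finS by (intro card_seteq)
            then show ?thesis using e by auto
          qed simp
          then have "R - contr e \<subseteq> ?S a \<union> closers F e" using cont by blast
          then have "card (R - contr e) \<le> card (?S a \<union> closers F e)"
            using finS fin_closers by (intro card_mono) simp_all
          then have "card (R - contr e) \<le> 3"
            using card_Un_le[of "?S a" "closers F e"] closers1[OF e(1)] Sa by linarith
          moreover have "card (conflicts F R - {a, v}) \<le> card (conflicts F R - {a})"
            using finQ by (intro card_mono) auto
          moreover have "card (conflicts F R - {a}) = card (conflicts F R) - 1" using a by simp
          moreover have "0 < card (conflicts F R)" using a finQ by (auto simp: card_gt_0_iff)
          ultimately show ?thesis using cardQ' split_card bound n by linarith
        qed
      qed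
      ultimately show ?thesis
        using acyclic_extensions_step[OF F R e(1)] unfolding contr_def by blast
    qed
  qed
qed

text \<open>The right side is the degree sum of \<open>F\<close>. A vertex of degree 2 in
  \<open>F\<close> blocks at most two edges of \<open>M\<close>. Every other blocked edge closes a
  cycle and has both ends of degree 1 in \<open>F\<close>; call these edges \<open>?K\<close>. By
  the degree bound on \<open>M\<close> they have at least as many ends as there are edges in
  \<open>?K\<close>. None of these ends is a conflict, since at most one edge of \<open>R\<close>
  remains there. So \<open>?K\<close> and the conflicts are charged to different vertices of degree
  1.\<close>

lemma card_unextendable:
  assumes F: "F \<subseteq> E" "path_forest F" and M: "M \<subseteq> E" "M \<inter> F = {}" "\<And>v. deg M v \<le> 2"
  defines "R \<equiv> {f \<in> M. path_forest (insert f F)}"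
  shows "card (M - R) + card (conflicts F R) \<le> 2 * card F"
proof -
  let ?D = "\<lambda>i. {v. deg F v = i}"
  have finF: "finite F" and finM: "finite M" using F M finite_edges by auto
  have finD: "finite (?D 1)" "finite (?D 2)"
    by (rule finite_subset[OF _ finite_deg_pos[OF F(1), of "\<lambda>_. True"]], auto)+
  have "\<Union>F \<subseteq> ?D 1 \<union> ?D 2"
  proof
    fix v assume "v \<in> \<Union>F"
    then have "0 < deg F v" "deg F v \<le> 2" using deg_pos_iff[OF finF] path_forestD(1)[OF F(2)] by auto
    then show "v \<in> ?D 1 \<union> ?D 2" by auto
  qed
  then have "2 * card F = (\<Sum>v\<in>?D 1 \<union> ?D 2. deg F v)"
    using finD F by (intro sum_deg[symmetric, OF finF]) (auto intro: card_edge)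
  also have "\<dots> = (\<Sum>v\<in>?D 1. deg F v) + (\<Sum>v\<in>?D 2. deg F v)"
    using finD by (intro sum.union_disjoint) auto
  also have "\<dots> = card (?D 1) + 2 * card (?D 2)" by simp
  finally have cardF: "2 * card F = card (?D 1) + 2 * card (?D 2)" .
  let ?K = "{f \<in> M - R. f \<subseteq> ?D 1}"
  have "M - R \<subseteq> (\<Union>v\<in>?D 2. {g \<in> M. v \<in> g}) \<union> ?K"
  proof
    fix f assume f: "f \<in> M - R"
    then have fF: "f \<notin> F" "f \<in> E" using M by auto
    have degf: "deg (insert f F) v = deg F v + (if v \<in> f then 1 else 0)" for v
      using F fF by (intro deg_insert')
    show "f \<in> (\<Union>v\<in>?D 2. {g \<in> M. v \<in> g}) \<union> ?K"
    proof (cases "\<exists>v\<in>f. deg F v = 2")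
      case True
      then show ?thesis using f by blast
    next
      case False
      have small: "deg F v \<le> 1" if "v \<in> f" for v
      proof -
        have "deg F v \<noteq> 2" using False that by blast
        then show ?thesis using path_forestD(1)[OF F(2), of v] by linarith
      qed
      have "deg (insert f F) v \<le> 2" for v
        using degf[of v] small[of v] path_forestD(1)[OF F(2), of v] by (cases "v \<in> f") auto
      moreover have "\<not> path_forest (insert f F)" using f by (simp add: R_def)
      ultimately obtain Z where Z: "Z \<subseteq> insert f F" "even_set Z" "Z \<noteq> {}"
        unfolding path_forest_def by blast
      have fZ: "f \<in> Z" using path_forestD(2)[OF F(2) _ Z(2)] Z by blast
      have finZ: "finite Z" by (rule finite_subset[OF Z(1)]) (simp add: finF)
      \<comment> \<open>A cycle through \<open>f\<close> continues at each end of \<open>f\<close>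
        by an edge of \<open>F\<close>.\<close>
      have "deg F v = 1" if v: "v \<in> f" for v
      proof -
        have "0 < deg Z v" unfolding deg_pos_iff[OF finZ] using fZ v by blast
        moreover have "even (deg Z v)" using Z(2) by (simp add: even_set_def)
        moreover have "deg Z v \<le> deg (insert f F) v" using Z(1) finF by (intro deg_mono) simp
        ultimately have "2 \<le> deg (insert f F) v" by presburger
        then show ?thesis using small[OF v] degf[of v] v by simp
      qed
      then show ?thesis using f by blast
    qed
  qed
  then have "card (M - R) \<le> card ((\<Union>v\<in>?D 2. {g \<in> M. v \<in> g}) \<union> ?K)"
    using finD finM by (intro card_mono) simp_all
  also have "\<dots> \<le> card (\<Union>v\<in>?D 2. {g \<in> M. v \<in> g}) + card ?K" by (rule card_Un_le)
  also have "card (\<Union>v\<in>?D 2. {g \<in> M. v \<in> g}) \<le> (\<Sum>v\<in>?D 2. deg M v)"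
    using card_UN_le[OF finD(2), of "\<lambda>v. {g \<in> M. v \<in> g}"] by (simp only: deg_def)
  also have "\<dots> \<le> (\<Sum>v\<in>?D 2. 2)" using M(3) by (intro sum_mono)
  finally have MR: "card (M - R) \<le> 2 * card (?D 2) + card ?K" by simp
  have KE: "?K \<subseteq> E" using M by auto
  have finK: "finite ?K" "finite (\<Union>?K)" using finite_edges[OF KE] finite_Union_edges[OF KE] by simp_all
  have "2 * card ?K = (\<Sum>v\<in>\<Union>?K. deg ?K v)"
    using finK KE by (intro sum_deg[symmetric]) (auto intro: card_edge)
  also have "\<dots> \<le> (\<Sum>v\<in>\<Union>?K. 2)"
    using M(3) deg_mono[OF finM, of ?K] by (intro sum_mono) (blast intro: order_trans)
  finally have "card ?K \<le> card (\<Union>?K)" by simp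
  moreover have "\<Union>?K \<inter> conflicts F R = {}"
  proof -
    have "deg R v \<noteq> 2" if v: "v \<in> f" "f \<in> M - R" for v f
    proof -
      have RM: "R \<subseteq> M" by (auto simp: R_def)
      then have "finite R" by (rule finite_subset[OF _ finM])
      then have "deg (insert f R) v = deg R v + 1" using v by (simp add: deg_insert)
      moreover have "deg (insert f R) v \<le> deg M v" using v RM finM by (intro deg_mono) auto
      ultimately show ?thesis using M(3)[of v] by linarith
    qed
    then show ?thesis unfolding conflicts_def by blast
  qed
  moreover have "\<Union>?K \<union> conflicts F R \<subseteq> ?D 1" by (auto simp: conflicts_def)
  then have "card (\<Union>?K \<union> conflicts F R) \<le> card (?D 1)" by (rule card_mono[OF finD(1)])
  ultimately have "card ?K + card (conflicts F R) \<le> card (?D 1)"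
    using card_Un_disjoint[OF finK(2) finite_conflicts[OF F(1)], of R] by linarith
  then show ?thesis using MR cardF by linarith
qed

text \<open>Induction on the edges outside \<open>M\<close>. Deleting one leaves the bound alone;
  contracting one lowers \<open>n\<close> by one and enlarges \<open>F\<close> by one, so
  \<open>2 * n + 2 * card F\<close> stays the same. When only edges of \<open>M\<close> remain,
  \<open>card_unextendable\<close> converts the bound into the one of
  \<open>acyclic_extensions_alive\<close>.\<close>

lemma acyclic_extensions:
  assumes "F \<subseteq> E" "path_forest F" "A \<subseteq> E" "F \<inter> A = {}"
    "\<And>a. a \<in> A \<Longrightarrow> path_forest (insert a F)"
    "M \<subseteq> E" "M \<inter> F = {}" "\<And>v. deg M v \<le> 2" "{f \<in> M. path_forest (insert f F)} \<subseteq> A"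
    "2 * n + 2 * card F \<le> card M"
  shows "acyclic_below E n (extensions F A)"
  using assms
proof (induction "card A" arbitrary: F A n rule: less_induct)
  case less
  note F = less.prems(1,2) and A = less.prems(3,4) and alive = less.prems(5)
    and M = less.prems(6-8) and MA = less.prems(9) and bound = less.prems(10)
  have finF: "finite F" and finA: "finite A" and finM: "finite M" using F A M finite_edges by auto
  show ?case
  proof (cases "A \<subseteq> M")
    case True
    then have eq: "A = {f \<in> M. path_forest (insert f F)}" using alive MA by blast
    have "card (M - A) + card (conflicts F A) \<le> 2 * card F"
      unfolding eq by (rule card_unextendable[OF F M])
    moreover have "card M \<le> card (M - A) + card A"
      using finA True by (subst card_Diff_subset) auto
    ultimately have "2 * n + card (conflicts F A) \<le> card A" using bound by linarith
    moreover have "deg A v \<le> 2" for v using deg_mono[OF finM True] M(3) by (rule order_trans)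
    ultimately show ?thesis using F A alive by (intro acyclic_extensions_alive) auto
  next
    case False
    then obtain e where e: "e \<in> A" "e \<notin> M" by blast
    show ?thesis
    proof (cases "n = 0")
      case True
      then show ?thesis by simp
    next
      case n: False
      have "acyclic_below E n (extensions F (A - {e}))"
      proof (rule less.hyps)
        show "card (A - {e}) < card A" using e finA by (intro card_Diff1_less)
      qed (use F A alive M MA bound e in auto)
      moreover have "acyclic_below E (n - 1)
          (extensions (insert e F) {a \<in> A - {e}. path_forest (insert a (insert e F))})"
        (is "acyclic_below _ _ (extensions _ ?A)")
      proof (rule less.hyps)
        have "?A \<subset> A" using e by blast
        then show "card ?A < card A" by (rule psubset_card_mono[OF finA])
        show "insert e F \<subseteq> E" "?A \<subseteq> E" "insert e F \<inter> ?A = {}" "M \<subseteq> E" "M \<inter> insert e F = {}"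
          using F A M e by auto
        show "path_forest (insert e F)" using alive e by blast
        show "{f \<in> M. path_forest (insert f (insert e F))} \<subseteq> ?A"
        proof
          fix f assume f: "f \<in> {f \<in> M. path_forest (insert f (insert e F))}"
          then have "path_forest (insert f F)"
            using finF by (intro path_forest_subset[of "insert f (insert e F)" "insert f F"]) auto
          then show "f \<in> ?A" using f MA e by blast
        qed
        have "card (insert e F) = Suc (card F)" using e A finF by (intro card_insert_disjoint) auto
        then show "2 * (n - 1) + 2 * card (insert e F) \<le> card M" using bound n by simp
      qed (use M in auto)
      ultimately show ?thesis by (rule acyclic_extensions_step[OF F(1) A(1) e(1)])
    qed
  qed
qed

section \<open>One linear forest meeting every cycle\<close>

lemma path_forest_singleton:
  assumes "e \<in> E"
  shows "path_forest {e}"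
  unfolding path_forest_def
proof (intro conjI allI impI)
  have d: "deg {e} v = (if v \<in> e then 1 else 0)" for v using deg_insert[of "{}" e v] by simp
  then show "deg {e} v \<le> 2" for v by simp
  fix Z assume Z: "Z \<subseteq> {e}" "even_set Z"
  obtain v where "v \<in> e" using card_edge[OF assms] by fastforce
  then have "odd (deg {e} v)" using d by simp
  then have "Z \<noteq> {e}" using Z(2) by (auto simp: even_set_def)
  then show "Z = {}" using Z(1) by blast
qed

text \<open>The colours for \<open>rainbow_simplex\<close> are the members of \<open>\<Z>\<close>.
  Its acyclicity condition for \<open>J\<close> comes from \<open>acyclic_extensions\<close> with
  nothing contracted and with \<open>M\<close> the union of those members of \<open>J\<close> that
  lie in one class of \<open>c\<close>.\<close>

theorem path_forest_transversal:
  assumes Z: "finite \<Z>" "\<Union>\<Z> \<subseteq> E" "disjoint \<Z>" "\<And>Z. Z \<in> \<Z> \<Longrightarrow> 2 * k \<le> card Z"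
    and c: "\<And>Z. Z \<in> \<Z> \<Longrightarrow> c Z < k" "\<And>i v. deg (\<Union>{Z \<in> \<Z>. c Z = i}) v \<le> 2"
  shows "\<exists>\<sigma>\<subseteq>\<Union>\<Z>. path_forest \<sigma> \<and> (\<forall>Z\<in>\<Z>. \<sigma> \<inter> Z \<noteq> {})"
proof -
  define col where "col e = (THE Z. Z \<in> \<Z> \<and> e \<in> Z)" for e
  have col: "col e = Z" if "Z \<in> \<Z>" "e \<in> Z" for e Z
    unfolding col_def using that Z(3) by (intro the_equality) (auto simp: disjoint_def)
  let ?X = "extensions {} (\<Union>\<Z>)"
  have pe: "path_forest {}" by (auto simp: path_forest_def)
  have "\<exists>\<sigma>\<in>?X. bij_betw col \<sigma> \<Z>"
  proof (rule rainbow_simplex[OF finite_E Z(1)])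
    show "?X \<subseteq> Pow E" using Z(2) by (auto simp: extensions_def)
    show "{} \<in> ?X" using pe by (simp add: extensions_def)
    fix J assume J: "J \<subseteq> \<Z>"
    have finJ: "finite J" using J Z(1) by (rule finite_subset)
    have JE: "\<Union>J \<subseteq> E" using J Z(2) by blast
    have "{\<sigma> \<in> ?X. col ` \<sigma> \<subseteq> J} = extensions {} (\<Union>J)"
    proof (intro equalityI subsetI)
      fix \<sigma> assume \<sigma>: "\<sigma> \<in> {\<sigma> \<in> ?X. col ` \<sigma> \<subseteq> J}"
      have "e \<in> \<Union>J" if e: "e \<in> \<sigma>" for e
      proof -
        obtain Z where "Z \<in> \<Z>" "e \<in> Z" using e \<sigma> by (auto simp: extensions_def)
        then have "col e \<in> J" "e \<in> col e" using col \<sigma> e by auto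
        then show ?thesis by blast
      qed
      then show "\<sigma> \<in> extensions {} (\<Union>J)" using \<sigma> by (auto simp: extensions_def)
    next
      fix \<sigma> assume \<sigma>: "\<sigma> \<in> extensions {} (\<Union>J)"
      have "col e \<in> J" if e: "e \<in> \<sigma>" for e
      proof -
        obtain Z where "Z \<in> J" "e \<in> Z" using e \<sigma> by (auto simp: extensions_def)
        then show ?thesis using col J by auto
      qed
      moreover have "\<Union>J \<subseteq> \<Union>\<Z>" using J by blast
      ultimately show "\<sigma> \<in> {\<sigma> \<in> ?X. col ` \<sigma> \<subseteq> J}" using \<sigma> by (auto simp: extensions_def)
    qed
    moreover have "acyclic_below E (card J) (extensions {} (\<Union>J))"
    proof -
      let ?J = "\<lambda>i. {Z \<in> J. c Z = i}"
      have "card J = (\<Sum>i<k. card (?J i))"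
      proof -
        have "J = (\<Union>i\<in>{..<k}. ?J i)" using c(1) J by auto
        moreover have "card (\<Union>i\<in>{..<k}. ?J i) = (\<Sum>i<k. card (?J i))"
          using finJ by (intro card_UN_disjoint) auto
        ultimately show ?thesis by simp
      qed
      \<comment> \<open>Pigeonhole over the \<open>k\<close> classes. Since each member has at least
        \<open>2 * k\<close> edges, this class provides at least \<open>2 * card J\<close> of
        them.\<close>
      have "\<exists>i. card J \<le> k * card (?J i)"
      proof (rule ccontr)
        assume "\<not> ?thesis"
        then have less: "k * card (?J i) < card J" for i by (simp add: not_le)
        have "0 < k"
        proof (rule ccontr)
          assume "\<not> 0 < k"
          then show False using \<open>card J = _\<close> less[of 0] by simp
        qed
        then have "(\<Sum>i<k. k * card (?J i)) < (\<Sum>i<k. card J)"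
          using less by (intro sum_strict_mono) auto
        then show False using \<open>card J = _\<close> by (simp flip: sum_distrib_left)
      qed
      then obtain i where i: "card J \<le> k * card (?J i)" by blast
      have "card (\<Union>(?J i)) = (\<Sum>Z\<in>?J i. card Z)"
      proof (rule card_Union_disjoint)
        show "disjoint (?J i)" using J by (intro pairwise_subset[OF Z(3)]) blast
        show "finite Z" if "Z \<in> ?J i" for Z using that JE by (intro finite_edges) blast
      qed
      also have "\<dots> \<ge> (\<Sum>Z\<in>?J i. 2 * k)" using J Z(4) by (intro sum_mono) auto
      finally have "2 * card J \<le> card (\<Union>(?J i))"
        using mult_le_mono2[OF i, of 2] by (simp add: mult.commute mult.left_commute)
      moreover have "deg (\<Union>(?J i)) v \<le> 2" for v
      proof -
        have "deg (\<Union>(?J i)) v \<le> deg (\<Union>{Z \<in> \<Z>. c Z = i}) v"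
          using J Z(2) by (intro deg_mono finite_edges) auto
        then show ?thesis using c(2)[of i v] by linarith
      qed
      ultimately show ?thesis
        using JE pe path_forest_singleton
        by (intro acyclic_extensions[where M = "\<Union>(?J i)"]) auto
    qed
    ultimately show "acyclic_below E (card J) {\<sigma> \<in> ?X. col ` \<sigma> \<subseteq> J}" by simp
  qed
  then obtain \<sigma> where \<sigma>: "\<sigma> \<in> ?X" "bij_betw col \<sigma> \<Z>" by blast
  have "\<sigma> \<inter> Z \<noteq> {}" if Z': "Z \<in> \<Z>" for Z
  proof -
    obtain e where e: "e \<in> \<sigma>" "Z = col e" using \<sigma>(2) Z' by (auto simp: bij_betw_def)
    then obtain W where "W \<in> \<Z>" "e \<in> W" using \<sigma>(1) by (auto simp: extensions_def)
    then show ?thesis using col e by auto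
  qed
  then show ?thesis using \<sigma>(1) by (intro exI[of _ \<sigma>]) (auto simp: extensions_def)
qed

end

section \<open>Two-factors\<close>

text \<open>Induction on the number of indices. If some nonempty proper subfamily \<open>K\<close>
  is tight, it is matched first and the rest is matched outside its union. Otherwise Hall's
  inequality is strict for all of these subfamilies, so an arbitrary value \<open>x\<close> can be
  given to one index and withdrawn from the others.\<close>

theorem hall_marriage:
  fixes A :: "'i \<Rightarrow> 'b set"
  assumes "finite I" "\<And>i. i \<in> I \<Longrightarrow> finite (A i)"
    "\<And>J. J \<subseteq> I \<Longrightarrow> card J \<le> card (\<Union>i\<in>J. A i)"
  shows "\<exists>f. inj_on f I \<and> (\<forall>i\<in>I. f i \<in> A i)"
  using assms
proof (induction "card I" arbitrary: I A rule: less_induct)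
  case less
  note finI = less.prems(1) and finA = less.prems(2) and hc = less.prems(3)
  show ?case
  proof (cases "\<exists>K. K \<subset> I \<and> K \<noteq> {} \<and> card (\<Union>i\<in>K. A i) \<le> card K")
    case True
    then obtain K where K: "K \<subset> I" "K \<noteq> {}" "card (\<Union>i\<in>K. A i) \<le> card K" by blast
    let ?B = "\<Union>i\<in>K. A i"
    have finK: "finite K" using K(1) finI by (meson finite_subset psubset_imp_subset)
    have finB: "finite ?B" using finK K(1) finA by auto
    have "\<exists>f. inj_on f K \<and> (\<forall>i\<in>K. f i \<in> A i)"
    proof (rule less.hyps)
      show "card K < card I" using K(1) finI by (rule psubset_card_mono[rotated])
      show "card J \<le> card (\<Union>i\<in>J. A i)" if "J \<subseteq> K" for J using that K(1) by (intro hc) blast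
    qed (use finK K(1) finA in auto)
    then obtain f where f: "inj_on f K" "\<And>i. i \<in> K \<Longrightarrow> f i \<in> A i" by blast
    have "\<exists>f. inj_on f (I - K) \<and> (\<forall>i\<in>I - K. f i \<in> A i - ?B)"
    proof (rule less.hyps)
      have "I - K \<subset> I" using K by blast
      then show "card (I - K) < card I" by (rule psubset_card_mono[OF finI])
      show "finite (I - K)" "\<And>i. i \<in> I - K \<Longrightarrow> finite (A i - ?B)" using finI finA by auto
      fix J assume J: "J \<subseteq> I - K"
      have finJ: "finite J" using J finI by (meson finite_Diff finite_subset)
      \<comment> \<open>Hall's condition for \<open>J \<union> K\<close>, reduced by the tight part
        \<open>K\<close>, is the condition for \<open>J\<close> in the remaining sets.\<close>
      have "card J + card K = card (J \<union> K)"
        using J finJ finK by (subst card_Un_disjoint) auto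
      also have "\<dots> \<le> card (\<Union>i\<in>J \<union> K. A i)" using J K(1) by (intro hc) blast
      also have "(\<Union>i\<in>J \<union> K. A i) = (\<Union>i\<in>J. A i - ?B) \<union> ?B" by blast
      also have "card \<dots> \<le> card (\<Union>i\<in>J. A i - ?B) + card ?B" by (rule card_Un_le)
      finally show "card J \<le> card (\<Union>i\<in>J. A i - ?B)" using K(3) by linarith
    qed
    then obtain g where g: "inj_on g (I - K)" "\<And>i. i \<in> I - K \<Longrightarrow> g i \<in> A i - ?B" by blast
    let ?h = "\<lambda>i. if i \<in> K then f i else g i"
    have "inj_on ?h I"
    proof (rule inj_onI)
      fix i j assume ij: "i \<in> I" "j \<in> I" "?h i = ?h j"
      consider "i \<in> K" "j \<in> K" | "i \<notin> K" "j \<notin> K" | "i \<in> K" "j \<notin> K" | "i \<notin> K" "j \<in> K" by blast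
      then show "i = j"
      proof cases
        case 1 then show ?thesis using ij f(1) by (auto dest: inj_onD)
      next
        case 2 then show ?thesis using ij g(1) by (auto dest: inj_onD)
      next
        case 3 then show ?thesis using ij f(2)[of i] g(2)[of j] by auto
      next
        case 4 then show ?thesis using ij f(2)[of j] g(2)[of i] by auto
      qed
    qed
    moreover have "\<forall>i\<in>I. ?h i \<in> A i" using f(2) g(2) by auto
    ultimately show ?thesis by blast
  next
    case False
    then have strict: "card K < card (\<Union>i\<in>K. A i)" if "K \<subset> I" "K \<noteq> {}" for K
      using that by (meson not_le)
    show ?thesis
    proof (cases "I = {}")
      case True
      then show ?thesis by simp
    next
      case False
      then obtain i where i: "i \<in> I" by blast
      then have "1 \<le> card (A i)" using hc[of "{i}"] by simp
      then obtain x where x: "x \<in> A i" by fastforce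
      have "\<exists>f. inj_on f (I - {i}) \<and> (\<forall>j\<in>I - {i}. f j \<in> A j - {x})"
      proof (rule less.hyps)
        show "card (I - {i}) < card I" using finI i by (rule card_Diff1_less)
        show "finite (I - {i})" "\<And>j. j \<in> I - {i} \<Longrightarrow> finite (A j - {x})" using finI finA by auto
        fix J assume J: "J \<subseteq> I - {i}"
        show "card J \<le> card (\<Union>j\<in>J. A j - {x})"
        proof (cases "J = {}")
          case False
          then have "card J < card (\<Union>j\<in>J. A j)" using J i by (intro strict) auto
          moreover have "(\<Union>j\<in>J. A j - {x}) = (\<Union>j\<in>J. A j) - {x}" by blast
          moreover have "card (\<Union>j\<in>J. A j) \<le> Suc (card ((\<Union>j\<in>J. A j) - {x}))"
            using card_Diff_singleton_if[of "\<Union>j\<in>J. A j" x] by (auto split: if_splits)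
          ultimately show ?thesis by simp
        qed simp
      qed
      then obtain f where f: "inj_on f (I - {i})" "\<And>j. j \<in> I - {i} \<Longrightarrow> f j \<in> A j - {x}" by blast
      have "inj_on (f(i := x)) (insert i (I - {i}))"
        unfolding inj_on_insert using f by (auto simp: inj_on_def)
      moreover have "insert i (I - {i}) = I" using i by blast
      ultimately have "inj_on (f(i := x)) I" by simp
      moreover have "\<forall>j\<in>I. (f(i := x)) j \<in> A j" using f(2) x by auto
      ultimately show ?thesis by blast
    qed
  qed
qed

text \<open>Koenig's theorem for regular bipartite multigraphs: the two sides are copies of
  \<open>U\<close>, and \<open>e\<close> joins \<open>t e\<close> on one side to \<open>h e\<close>
  on the other. By Hall's theorem there is a perfect matching; removing it lowers the degree by
  one.\<close>

lemma regular_bipartite_edge_colouring: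
  fixes t h :: "'e \<Rightarrow> 'v"
  assumes "finite E" "finite U" "t ` E \<subseteq> U" "h ` E \<subseteq> U"
    "\<And>v. v \<in> U \<Longrightarrow> card {e \<in> E. t e = v} = k" "\<And>v. v \<in> U \<Longrightarrow> card {e \<in> E. h e = v} = k"
  shows "\<exists>c. \<forall>i. inj_on t {e \<in> E. c e = i} \<and> inj_on h {e \<in> E. c e = i} \<and> (\<forall>e\<in>E. c e < k)"
  using assms
proof (induction k arbitrary: E)
  case 0
  have "E = {}"
  proof (rule ccontr)
    assume "E \<noteq> {}"
    then obtain e where e: "e \<in> E" by blast
    then have "e \<in> {x \<in> E. t x = t e}" "t e \<in> U" using 0 by auto
    then show False using 0(5)[of "t e"] 0(1) by auto
  qed
  then show ?case by simp
next
  case (Suc k)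
  note finE = Suc.prems(1) and finU = Suc.prems(2) and th = Suc.prems(3,4) and ct = Suc.prems(5)
    and ch = Suc.prems(6)
  have count: "card {e \<in> E. p e \<in> J} = card J * Suc k"
    if "J \<subseteq> U" "\<And>v. v \<in> U \<Longrightarrow> card {e \<in> E. p e = v} = Suc k" for J and p :: "'e \<Rightarrow> 'v"
  proof -
    have "{e \<in> E. p e \<in> J} = (\<Union>v\<in>J. {e \<in> E. p e = v})" by blast
    moreover have "card \<dots> = (\<Sum>v\<in>J. card {e \<in> E. p e = v})"
      using finE that(1) finU by (intro card_UN_disjoint) (auto intro: finite_subset)
    moreover have "\<dots> = (\<Sum>v\<in>J. Suc k)" using that by (intro sum.cong) auto
    ultimately show ?thesis by simp
  qed
  let ?A = "\<lambda>v. h ` {e \<in> E. t e = v}"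
  have "\<exists>f. inj_on f U \<and> (\<forall>v\<in>U. f v \<in> ?A v)"
  proof (rule hall_marriage[OF finU])
    show "finite (?A v)" for v using finE by simp
    fix J assume J: "J \<subseteq> U"
    let ?N = "\<Union>v\<in>J. ?A v"
    have NU: "?N \<subseteq> U" using th by auto
    have "card J * Suc k = card {e \<in> E. t e \<in> J}" using count[OF J ct] by simp
    also have "\<dots> \<le> card {e \<in> E. h e \<in> ?N}" using finE by (intro card_mono) auto
    also have "\<dots> = card ?N * Suc k" using count[OF NU ch] by simp
    finally show "card J \<le> card ?N" by (simp only: mult_le_cancel2)
  qed
  then obtain f where f: "inj_on f U" "\<And>v. v \<in> U \<Longrightarrow> f v \<in> ?A v" by blast
  have "\<exists>e. e \<in> E \<and> t e = v \<and> h e = f v" if "v \<in> U" for v using f(2)[OF that] by auto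
  then obtain m where m: "\<And>v. v \<in> U \<Longrightarrow> m v \<in> E \<and> t (m v) = v \<and> h (m v) = f v" by metis
  \<comment> \<open>Because \<open>f\<close> permutes \<open>U\<close>, the matching
    \<open>?M\<close> takes exactly one edge at every vertex of either side.\<close>
  have fU: "f ` U = U"
    using f(1) finU m th by (intro endo_inj_surj) force+
  let ?M = "m ` U"
  have tfib: "{e \<in> E - ?M. t e = v} = {e \<in> E. t e = v} - {m v}" "m v \<in> {e \<in> E. t e = v}"
    if "v \<in> U" for v using m that by auto
  have hfib: "{e \<in> E - ?M. h e = f v} = {e \<in> E. h e = f v} - {m v}" "m v \<in> {e \<in> E. h e = f v}"
    if "v \<in> U" for v using m that f(1) by (auto dest: inj_onD)
  have "\<exists>c. \<forall>i. inj_on t {e \<in> E - ?M. c e = i} \<and> inj_on h {e \<in> E - ?M. c e = i} \<and> (\<forall>e\<in>E - ?M. c e < k)"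
  proof (rule Suc.IH)
    show "card {e \<in> E - ?M. t e = v} = k" if "v \<in> U" for v
      using tfib[OF that] ct[OF that] finE by simp
    show "card {e \<in> E - ?M. h e = w} = k" if w: "w \<in> U" for w
    proof -
      obtain v where v: "v \<in> U" "w = f v" using w fU by blast
      show ?thesis unfolding v(2) using hfib[OF v(1)] ch[OF w] v finE by simp
    qed
  qed (use finE finU th in auto)
  then obtain c where c: "\<And>i. inj_on t {e \<in> E - ?M. c e = i}" "\<And>i. inj_on h {e \<in> E - ?M. c e = i}"
    "\<And>e. e \<in> E - ?M \<Longrightarrow> c e < k" by blast
  let ?c = "\<lambda>e. if e \<in> ?M then k else c e"
  have "inj_on t {e \<in> E. ?c e = i} \<and> inj_on h {e \<in> E. ?c e = i}" for i
  proof (cases "i = k")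
    case True
    then have "{e \<in> E. ?c e = i} \<subseteq> ?M" using c(3) by (auto split: if_splits)
    moreover have "inj_on t ?M" "inj_on h ?M" using m f(1) by (auto simp: inj_on_def)
    ultimately show ?thesis by (meson inj_on_subset)
  next
    case False
    then have "{e \<in> E. ?c e = i} = {e \<in> E - ?M. c e = i}" by auto
    then show ?thesis using c(1,2)[of i] by simp
  qed
  moreover have "\<forall>e\<in>E. ?c e < Suc k" using c(3) by (auto intro: less_SucI)
  ultimately show ?case by (intro exI[of _ ?c]) blast
qed

context edge_set begin

text \<open>The edges are first oriented with \<open>k\<close> heads and \<open>k\<close> tails at
  every vertex: give each vertex \<open>k\<close> slots and use Hall's theorem to assign to each
  edge a slot at one of its ends, its head. Then the bipartite graph of tails and heads is
  \<open>k\<close>-regular, and each of its matchings contributes at most one tail and one head per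
  vertex, hence degree at most 2.\<close>

theorem petersen_two_factors:
  assumes U: "finite U" "\<Union>E \<subseteq> U" and reg: "\<And>v. v \<in> U \<Longrightarrow> deg E v = 2 * k"
  shows "\<exists>c. (\<forall>e\<in>E. c e < k) \<and> (\<forall>i v. deg {e \<in> E. c e = i} v \<le> 2)"
proof -
  have "\<exists>g. inj_on g E \<and> (\<forall>e\<in>E. g e \<in> e \<times> {..<k})"
  proof (rule hall_marriage[OF finite_E])
    show "finite (e \<times> {..<k})" if "e \<in> E" for e using finite_edge[OF that] by simp
    fix J assume J: "J \<subseteq> E"
    have "2 * card J = (\<Sum>v\<in>\<Union>J. deg J v)"
      using J finite_edges[OF J] finite_Union_edges[OF J]
      by (intro sum_deg[symmetric]) (auto intro: card_edge)
    also have "\<dots> \<le> (\<Sum>v\<in>\<Union>J. 2 * k)"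
    proof (rule sum_mono)
      fix v assume "v \<in> \<Union>J"
      then have "v \<in> U" using J U by blast
      then show "deg J v \<le> 2 * k" using deg_mono[OF finite_E J, of v] reg by simp
    qed
    finally have "card J \<le> card (\<Union>J \<times> {..<k})" by (simp add: card_cartesian_product)
    also have "\<Union>J \<times> {..<k} = (\<Union>e\<in>J. e \<times> {..<k})" by blast
    finally show "card J \<le> card (\<Union>e\<in>J. e \<times> {..<k})" .
  qed
  then obtain g where g: "inj_on g E" "\<And>e. e \<in> E \<Longrightarrow> g e \<in> e \<times> {..<k}" by blast
  define h where "h e = fst (g e)" for e
  have h: "h e \<in> e" if "e \<in> E" for e using g(2)[OF that] by (auto simp: h_def)
  have "\<exists>w. e = {h e, w} \<and> w \<noteq> h e" if "e \<in> E" for e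
    using card_edge[OF that] h[OF that] by (auto simp: card_2_iff)
  then obtain t where t: "\<And>e. e \<in> E \<Longrightarrow> e = {h e, t e} \<and> t e \<noteq> h e" by metis
  have ends: "v \<in> e \<longleftrightarrow> h e = v \<or> t e = v" if "e \<in> E" for e v
    using t[OF that] by (metis insert_iff singletonD)
  then have "h e \<in> U \<and> t e \<in> U" if "e \<in> E" for e using that U(2) by blast
  then have hU: "h ` E \<subseteq> U" "t ` E \<subseteq> U" by auto
  have le: "card {e \<in> E. h e = v} \<le> k" for v
  proof -
    have "g ` {e \<in> E. h e = v} \<subseteq> {v} \<times> {..<k}" using g(2) by (force simp: h_def)
    then have "card (g ` {e \<in> E. h e = v}) \<le> card ({v} \<times> {..<k})" by (intro card_mono) auto
    moreover have "card (g ` {e \<in> E. h e = v}) = card {e \<in> E. h e = v}"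
      using g(1) by (intro card_image) (auto intro: inj_on_subset)
    ultimately show ?thesis by (simp add: card_cartesian_product)
  qed
  have Eh: "(\<Union>v\<in>U. {e \<in> E. h e = v}) = E" using hU(1) by auto
  have "card (\<Union>v\<in>U. {e \<in> E. h e = v}) = (\<Sum>v\<in>U. card {e \<in> E. h e = v})"
    using U(1) finite_E by (intro card_UN_disjoint) auto
  moreover have "2 * card E = (\<Sum>v\<in>U. 2 * k)"
  proof -
    have "(\<Sum>v\<in>U. deg E v) = 2 * card E"
      using finite_E U by (intro sum_deg) (auto intro: card_edge)
    then show ?thesis using reg by simp
  qed
  ultimately have sum: "(\<Sum>v\<in>U. card {e \<in> E. h e = v}) = (\<Sum>v\<in>U. k)"
    unfolding Eh by simp
  \<comment> \<open>The numbers of heads are at most \<open>k\<close> each and add up to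
    \<open>card E\<close>, which is \<open>k\<close> times the number of vertices. So each bound is
    attained.\<close>
  have ch: "card {e \<in> E. h e = v} = k" if "v \<in> U" for v
    using sum_mono_inv[OF sum le that U(1)] .
  have ct: "card {e \<in> E. t e = v} = k" if "v \<in> U" for v
  proof -
    have "{e \<in> E. v \<in> e} = {e \<in> E. h e = v} \<union> {e \<in> E. t e = v}"
      using ends[of _ v] by blast
    moreover have "{e \<in> E. h e = v} \<inter> {e \<in> E. t e = v} = {}" using t by auto
    ultimately have "deg E v = card {e \<in> E. h e = v} + card {e \<in> E. t e = v}"
      unfolding deg_def using finite_E by (simp add: card_Un_disjoint)
    then show ?thesis using reg[OF that] ch[OF that] by simp
  qed
  obtain c where c: "\<And>i. inj_on t {e \<in> E. c e = i}" "\<And>i. inj_on h {e \<in> E. c e = i}" "\<forall>e\<in>E. c e < k"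
    using regular_bipartite_edge_colouring[OF finite_E U(1) hU(2,1) ct ch] by blast
  have "deg {e \<in> E. c e = i} v \<le> 2" for i v
  proof -
    have one: "card {e \<in> C. p e = v} \<le> 1" if "inj_on p C" "C \<subseteq> E" for p :: "'a set \<Rightarrow> 'a" and C
    proof -
      have "finite C" using that(2) by (rule finite_edges)
      then show ?thesis
        using that(1) by (auto simp: card_le_Suc0_iff_eq dest: inj_onD)
    qed
    let ?C = "{e \<in> E. c e = i}"
    have "{e \<in> ?C. v \<in> e} = {e \<in> ?C. h e = v} \<union> {e \<in> ?C. t e = v}"
      using ends[of _ v] by blast
    then have "deg ?C v \<le> card {e \<in> ?C. h e = v} + card {e \<in> ?C. t e = v}"
      unfolding deg_def using card_Un_le[of "{e \<in> ?C. h e = v}" "{e \<in> ?C. t e = v}"] by presburger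
    moreover have "card {e \<in> ?C. h e = v} \<le> 1" by (rule one[OF c(2)]) blast
    moreover have "card {e \<in> ?C. t e = v} \<le> 1" by (rule one[OF c(1)]) blast
    ultimately show ?thesis by linarith
  qed
  then show ?thesis using c(3) by blast
qed

end

section \<open>Walks and girth\<close>

definition edges_of :: "('a \<times> 'a) set \<Rightarrow> 'a set set" where
  "edges_of A = (\<lambda>(u, v). {u, v}) ` A"

definition arcs_of :: "'a set set \<Rightarrow> ('a \<times> 'a) set" where
  "arcs_of H = {(u, v). {u, v} \<in> H}"

definition is_path :: "('a \<times> 'a) set \<Rightarrow> 'a \<Rightarrow> ('a \<times> 'a) list \<Rightarrow> 'a \<Rightarrow> bool" where
  "is_path A u p v \<longleftrightarrow> pcas u p v \<and> set p \<subseteq> A \<and> distinct (pawalk_verts u p)"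

lemma edges_of_insert [simp]: "edges_of (insert (u, v) A) = insert {u, v} (edges_of A)"
  by (simp add: edges_of_def)

lemma edges_of_empty [simp]: "edges_of {} = {}"
  by (simp add: edges_of_def)

lemma edges_of_subset_iff: "edges_of A \<subseteq> H \<longleftrightarrow> A \<subseteq> arcs_of H"
  by (auto simp: edges_of_def arcs_of_def)

lemma doubleton_in_edges_of: "{x, y} \<in> edges_of A \<longleftrightarrow> (x, y) \<in> A \<union> A\<inverse>"
  by (auto simp: edges_of_def doubleton_eq_iff image_iff)

lemma sym_arcs_of: "(u, v) \<in> arcs_of H \<longleftrightarrow> (v, u) \<in> arcs_of H"
  by (simp add: arcs_of_def insert_commute)

lemma in_pawalk_verts: "e \<in> set p \<Longrightarrow> fst e \<in> set (pawalk_verts u p)"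
  by (induction p arbitrary: u) auto

lemma start_in_pawalk_verts: "pcas u p v \<Longrightarrow> u \<in> set (pawalk_verts u p)"
  by (cases p) auto

lemma end_in_pawalk_verts: "pcas u p v \<Longrightarrow> v \<in> set (pawalk_verts u p)"
  by (induction p arbitrary: u) auto

lemma edges_of_subset_verts:
  "pcas u p v \<Longrightarrow> e \<in> edges_of (set p) \<Longrightarrow> e \<subseteq> set (pawalk_verts u p)"
proof (induction p arbitrary: u)
  case (Cons a p)
  obtain x y where a: "a = (x, y)" by (cases a)
  have p: "pcas y p v" and x: "x = u" using Cons.prems a by auto
  have "y \<in> set (pawalk_verts y p)" using p by (rule start_in_pawalk_verts)
  then show ?case using Cons.IH[OF p] Cons.prems(2) a x by auto
qed simp

text \<open>The summands for the ends let one formula cover inner vertices (degree 2), the ends of a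
  nonempty path (degree 1) and the path with a single vertex, where \<open>u = v\<close> and the
  degree is 0.\<close>

lemma deg_path:
  assumes "pcas u p v" "distinct (pawalk_verts u p)"
  shows "deg (edges_of (set p)) x + (if x = u then 1 else 0) + (if x = v then 1 else 0)
    = (if x \<in> set (pawalk_verts u p) then 2 else 0)"
  using assms
proof (induction p arbitrary: u)
  case Nil
  then show ?case by simp
next
  case (Cons a p)
  obtain w where a: "a = (u, w)" using Cons.prems by (cases a) auto
  have p: "pcas w p v" "distinct (pawalk_verts w p)" and u: "u \<notin> set (pawalk_verts w p)"
    using Cons.prems a by auto
  have "{u, w} \<notin> edges_of (set p)" using edges_of_subset_verts[OF p(1), of "{u, w}"] u by blast
  moreover have "finite (edges_of (set p))" by (simp add: edges_of_def)
  ultimately have "deg (edges_of (set (a # p))) x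
      = deg (edges_of (set p)) x + (if x \<in> {u, w} then 1 else 0)"
    using a by (simp add: deg_insert)
  moreover have "w \<noteq> u" using start_in_pawalk_verts[OF p(1)] u by blast
  ultimately show ?case using Cons.IH[OF p] a u by (auto split: if_splits)
qed

lemma card_edges_of_path:
  assumes "pcas u p v" "distinct (pawalk_verts u p)"
  shows "card (edges_of (set p)) = length p"
  using assms
proof (induction p arbitrary: u)
  case (Cons a p)
  obtain w where a: "a = (u, w)" using Cons.prems by (cases a) auto
  have p: "pcas w p v" "distinct (pawalk_verts w p)" and u: "u \<notin> set (pawalk_verts w p)"
    using Cons.prems a by auto
  have "{u, w} \<notin> edges_of (set p)" using edges_of_subset_verts[OF p(1), of "{u, w}"] u by blast
  moreover have "finite (edges_of (set p))" by (simp add: edges_of_def)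
  ultimately show ?case using Cons.IH[OF p] a by simp
qed simp

lemma pcas_snoc: "pcas u p v \<Longrightarrow> pcas u (p @ [(v, y)]) y"
  by (induction p arbitrary: u) auto

lemma pawalk_verts_snoc: "pcas u p v \<Longrightarrow> pawalk_verts u (p @ [(v, y)]) = pawalk_verts u p @ [y]"
  by (induction p arbitrary: u) auto

lemma is_path_snoc:
  assumes "is_path A u p v" "(v, y) \<in> A" "y \<notin> set (pawalk_verts u p)"
  shows "is_path A u (p @ [(v, y)]) y"
  using assms by (simp add: is_path_def pcas_snoc pawalk_verts_snoc)

lemma is_path_length:
  assumes "finite A" "is_path A u p v"
  shows "length p \<le> card A"
proof -
  have "distinct (pawalk_verts u p) \<Longrightarrow> distinct p"
    by (induction p arbitrary: u) (auto dest: in_pawalk_verts)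
  then have "length p = card (set p)" using assms(2) by (simp add: is_path_def distinct_card)
  also have "\<dots> \<le> card A" using assms by (intro card_mono) (auto simp: is_path_def)
  finally show ?thesis .
qed

lemma longest_path:
  assumes "finite A" "is_path A u0 p0 v0" "Q u0 p0 v0"
  obtains u p v where "is_path A u p v" "Q u p v"
    "\<And>u' p' v'. is_path A u' p' v' \<Longrightarrow> Q u' p' v' \<Longrightarrow> length p' \<le> length p"
proof -
  let ?P = "\<lambda>(u, p, v). is_path A u p v \<and> Q u p v"
  let ?l = "\<lambda>(u, p, v). length p"
  have "?P (u0, p0, v0)" using assms by simp
  moreover have "\<forall>x. ?P x \<longrightarrow> ?l x < Suc (card A)"
    using is_path_length[OF assms(1)] by (auto simp: less_Suc_eq_le)
  ultimately obtain x where x: "?P x \<and> (\<forall>y. ?P y \<longrightarrow> ?l y \<le> ?l x)"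
    using ex_has_greatest_nat[of ?P "(u0, p0, v0)" ?l "Suc (card A)"] by blast
  obtain u p v where "x = (u, p, v)" by (cases x)
  then show ?thesis using x by (intro that[of u p v]) auto
qed

lemma deg_path_inner:
  assumes "is_path A u p v" "x \<in> set (pawalk_verts u p)" "x \<noteq> u" "x \<noteq> v"
  shows "deg (edges_of (set p)) x = 2"
  using assms deg_path[of u p v x] by (simp add: is_path_def)

lemma star_in_path:
  assumes H: "finite H" "deg H x \<le> 2" and p: "is_path (arcs_of H) u p v"
    and x: "deg (edges_of (set p)) x = 2" and e: "e \<in> H" "x \<in> e"
  shows "e \<in> edges_of (set p)"
proof -
  have "edges_of (set p) \<subseteq> H" using p by (simp add: is_path_def edges_of_subset_iff)
  then have "{e \<in> edges_of (set p). x \<in> e} = {e \<in> H. x \<in> e}"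
    using H x by (intro deg_eq_imp_same_star) simp_all
  then show ?thesis using e by blast
qed

text \<open>A longest path in \<open>Z\<close> ends in a vertex \<open>v\<close> where it has degree
  1, so by evenness \<open>Z\<close> has another edge \<open>f\<close> there. By maximality
  \<open>f\<close> leads back to the path, and inner vertices of the path have no edges to spare, so
  it leads to the start \<open>u\<close>. The resulting cycle uses only edges of
  \<open>Z\<close>.\<close>

lemma card_even_set_ge_girth:
  assumes G: "pair_graph G" and girth: "enat g \<le> girth G"
    and Z: "finite Z" "arcs_of Z \<subseteq> parcs G" "\<And>e. e \<in> Z \<Longrightarrow> card e = 2"
    "even_set Z" "\<And>v. deg Z v \<le> 2" "Z \<noteq> {}"
  shows "g \<le> card Z"
proof -
  interpret G: pair_graph G by (rule G)
  obtain e where "e \<in> Z" using Z by blast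
  then obtain a b where ab: "{a, b} \<in> Z" "a \<noteq> b" using Z(3) by (metis card_2_iff)
  let ?A = "arcs_of Z"
  have finA: "finite ?A" using Z(2) G.pair_finite_arcs by (rule finite_subset)
  have "is_path ?A a [(a, b)] b" using ab by (simp add: is_path_def arcs_of_def)
  then obtain u p v where p: "is_path ?A u p v"
    and "p \<noteq> []" and long: "\<And>u' p' v'. is_path ?A u' p' v' \<Longrightarrow> p' \<noteq> [] \<Longrightarrow> length p' \<le> length p"
    by (rule longest_path[OF finA, where Q = "\<lambda>u p v. p \<noteq> []"]) auto
  let ?E = "edges_of (set p)" and ?W = "set (pawalk_verts u p)"
  have pc: "pcas u p v" "distinct (pawalk_verts u p)" "set p \<subseteq> ?A"
    using p by (auto simp: is_path_def)
  have EZ: "?E \<subseteq> Z" using pc by (simp add: edges_of_subset_iff)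
  have finE: "finite ?E" by (simp add: edges_of_def)
  have "v \<noteq> u"
  proof -
    obtain a q where q: "p = a # q" using \<open>p \<noteq> []\<close> by (cases p) auto
    then have "v \<in> set (pawalk_verts (snd a) q)" "u \<notin> set (pawalk_verts (snd a) q)"
      using pc end_in_pawalk_verts[of "snd a" q v] by auto
    then show ?thesis by blast
  qed
  have vW: "v \<in> ?W" and uW: "u \<in> ?W" using end_in_pawalk_verts[OF pc(1)] start_in_pawalk_verts[OF pc(1)] by simp_all
  have degv: "deg ?E v = 1" using deg_path[OF pc(1,2), of v] vW \<open>v \<noteq> u\<close> by simp
  moreover have "deg ?E v \<le> deg Z v" using EZ Z(1) by (intro deg_mono)
  moreover have "even (deg Z v)" using Z(4) by (simp add: even_set_def)
  ultimately have "deg ?E v < deg Z v" by (metis le_neq_implies_less odd_one)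
  then have "\<not> {e \<in> Z. v \<in> e} \<subseteq> {e \<in> ?E. v \<in> e}"
    unfolding deg_def using card_mono[of "{e \<in> ?E. v \<in> e}" "{e \<in> Z. v \<in> e}"] finE by auto
  then obtain f where f: "f \<in> Z" "v \<in> f" "f \<notin> ?E" by blast
  then obtain y where y: "f = {v, y}" "y \<noteq> v"
    using Z(3)[OF f(1)] by (auto simp: card_2_iff)
  have vy: "(v, y) \<in> ?A" using f y by (simp add: arcs_of_def)
  have yW: "y \<in> ?W"
  proof (rule ccontr)
    assume "y \<notin> ?W"
    then have "is_path ?A u (p @ [(v, y)]) y" using p vy by (intro is_path_snoc)
    then have "length (p @ [(v, y)]) \<le> length p" by (rule long) simp
    then show False by simp
  qed
  have "y = u"
  proof (rule ccontr)
    assume "y \<noteq> u"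
    then have "deg ?E y = 2" using p yW y(2) by (intro deg_path_inner)
    then have "f \<in> ?E" using star_in_path[OF Z(1) Z(5) p] f y by blast
    then show False using f by blast
  qed
  let ?c = "p @ [(v, u)]"
  \<comment> \<open>If the path were one arc, \<open>f\<close> would be its edge. So the closed walk
    is no back-and-forth walk and counts for the girth.\<close>
  have "length p \<noteq> 1"
  proof
    assume "length p = 1"
    then obtain a where "p = [a]" by (auto simp: length_Suc_conv)
    then have "p = [(u, v)]" using pc by (cases a) auto
    then show False using f y \<open>y = u\<close> by (simp add: insert_commute)
  qed
  then have len: "3 \<le> length ?c" using \<open>p \<noteq> []\<close> by (cases p) (auto simp: Suc_le_eq)
  have cyc: "pre_digraph.cycle (with_proj G) ?c"
    unfolding pre_digraph.cycle_def pre_digraph.awalk_def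
  proof (intro exI[of _ u] conjI)
    show sub: "set ?c \<subseteq> arcs (with_proj G)" using pc vy Z(2) \<open>y = u\<close> by auto
    then show "u \<in> verts (with_proj G)" using G.in_arcsD2[of v u] by auto
    show "pre_digraph.cas (with_proj G) u ?c u"
      by (simp only: cas_with_proj_eq pcas_snoc[OF pc(1)])
    have "pawalk_verts u ?c = pawalk_verts u p @ [u]" using pc by (simp add: pawalk_verts_snoc)
    moreover have "pawalk_verts u p = u # tl (pawalk_verts u p)"
      using pc \<open>p \<noteq> []\<close> by (cases p) auto
    then have "distinct (tl (pawalk_verts u p) @ [u])"
      using pc(2) by (metis distinct.simps(2) distinct1_rotate rotate1.simps(2))
    ultimately show "distinct (tl (pre_digraph.awalk_verts (with_proj G) u ?c))"
      using \<open>pawalk_verts u p = _\<close>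
      by (metis awalk_verts_with_proj_eq append_Cons list.sel(3))
  qed simp
  have "girth G \<le> enat (length ?c)"
    unfolding girth_def using cyc len by (intro INF_lower) simp
  then have "enat g \<le> enat (length ?c)" using girth by (rule order_trans[rotated])
  then have "g \<le> length ?c" by simp
  also have "length ?c = Suc (card ?E)" using card_edges_of_path[OF pc(1,2)] by simp
  also have "\<dots> = card (insert f ?E)" using f finE by simp
  also have "\<dots> \<le> card Z" using f EZ Z(1) by (intro card_mono) auto
  finally show ?thesis .
qed

text \<open>Inner vertices of the path are saturated, and the ends have no neighbours outside the
  path. What remains is an edge joining the two ends, which would close a cycle.\<close>

lemma maximal_path_closed:
  assumes H: "finite H" "path_forest H" "\<And>e. e \<in> H \<Longrightarrow> card e = 2"
    and p: "is_path (arcs_of H) u p v"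
    and maxv: "\<And>y. (v, y) \<in> arcs_of H \<Longrightarrow> y \<in> set (pawalk_verts u p)"
    and maxu: "\<And>y. (y, u) \<in> arcs_of H \<Longrightarrow> y \<in> set (pawalk_verts u p)"
    and xy: "(x, y) \<in> arcs_of H" "x \<in> set (pawalk_verts u p)"
  shows "(x, y) \<in> set p \<union> (set p)\<inverse>"
proof -
  let ?E = "edges_of (set p)" and ?W = "set (pawalk_verts u p)"
  have pc: "pcas u p v" "distinct (pawalk_verts u p)" "set p \<subseteq> arcs_of H"
    using p by (auto simp: is_path_def)
  have EH: "?E \<subseteq> H" using pc by (simp add: edges_of_subset_iff)
  have e: "{x, y} \<in> H" using xy by (simp add: arcs_of_def)
  have "{x, y} \<in> ?E"
  proof (rule ccontr)
    assume nE: "{x, y} \<notin> ?E"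
    have inner: "w = u \<or> w = v" if w: "w \<in> ?W" "w \<in> {x, y}" for w
    proof (rule ccontr)
      assume "\<not> (w = u \<or> w = v)"
      then have "deg ?E w = 2" using p w by (intro deg_path_inner) auto
      then have "{x, y} \<in> ?E" using star_in_path[OF H(1) path_forestD(1)[OF H(2)] p _ e] w by blast
      then show False using nE by blast
    qed
    have x: "x = u \<or> x = v" using inner xy by simp
    then have "y \<in> ?W" using maxu[of y] maxv[of y] xy sym_arcs_of[of x y H] by auto
    then have y: "y = u \<or> y = v" using inner by simp
    have "x \<noteq> y" using H(3)[OF e] by auto
    then have uv: "{x, y} = {u, v}" "u \<noteq> v" using x y by auto
    let ?Z = "insert {u, v} ?E"
    have "deg ?Z w = (if w \<in> ?W then 2 else 0)" for w
    proof -
      have "deg ?Z w = deg ?E w + (if w \<in> {u, v} then 1 else 0)"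
        using nE uv by (intro deg_insert) (simp_all add: edges_of_def)
      then show ?thesis using deg_path[OF pc(1,2), of w] uv(2) by (auto split: if_splits)
    qed
    then have "even_set ?Z" by (simp add: even_set_def)
    moreover have "?Z \<subseteq> H" using EH e uv by simp
    ultimately show False using path_forestD(2)[OF H(2)] by blast
  qed
  then show ?thesis by (simp only: doubleton_in_edges_of)
qed

section \<open>From path forests to graphs whose components are paths\<close>

lemma path_reachable:
  assumes "pcas u p v" "set p \<subseteq> R" "set (pawalk_verts u p) \<subseteq> W" "x \<in> set (pawalk_verts u p)"
  shows "(u, x) \<in> rtrancl_on W R"
  using assms
proof (induction p arbitrary: u)
  case (Cons a p)
  obtain w where a: "a = (u, w)" using Cons.prems by (cases a) auto
  show ?case
  proof (cases "x = u")
    case False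
    then have "(w, x) \<in> rtrancl_on W R" using Cons.prems a by (intro Cons.IH) auto
    then show ?thesis using Cons.prems a by (intro converse_rtrancl_on_into_rtrancl_on[of u w]) auto
  qed (use Cons.prems a in auto)
qed auto

text \<open>Given a component \<open>C\<close>, take a longest path among those meeting it. By
  maximality every arc at the path runs along it, so \<open>C\<close> is contained in the path. The
  path is itself a connected subgraph, so it equals \<open>C\<close> by maximality of
  \<open>C\<close>.\<close>

lemma linear_forest_of_path_forest:
  assumes V: "finite V" "\<Union>H \<subseteq> V" and H: "finite H" "path_forest H" "\<And>e. e \<in> H \<Longrightarrow> card e = 2"
  shows "linear_forest \<lparr>pverts = V, parcs = arcs_of H\<rparr>"
proof -
  let ?A = "arcs_of H"
  define F where "F = \<lparr>pverts = V, parcs = ?A\<rparr>"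
  have F [simp]: "pverts F = V" "parcs F = ?A" by (simp_all add: F_def)
  have AV: "?A \<subseteq> V \<times> V" using V(2) by (auto simp: arcs_of_def)
  have finA: "finite ?A" using AV V(1) by (auto intro: finite_subset)
  have symA: "sym ?A" by (intro symI) (rule sym_arcs_of[THEN iffD1])
  have irr: "a \<noteq> b" if "(a, b) \<in> ?A" for a b
    using H(3)[of "{a, b}"] that by (auto simp: arcs_of_def)
  have pg: "pair_graph F"
  proof unfold_locales
    show "symmetric (with_proj F)" using symA by (simp add: symmetric_def)
  qed (use V finA AV irr in auto)
  then interpret F: pair_graph F .
  have "path_graph C" if C: "pre_digraph.max_subgraph (with_proj F) Digraph_Component.connected C" for C
  proof -
    have sub: "subgraph C (with_proj F)" and con: "Digraph_Component.connected C"
      and max: "\<And>D. subgraph C D \<Longrightarrow> subgraph D (with_proj F) \<Longrightarrow> Digraph_Component.connected D \<Longrightarrow> D = C"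
      using C unfolding pre_digraph.max_subgraph_def by blast+
    have CA: "verts C \<subseteq> V" "arcs C \<subseteq> ?A" and wfC: "wf_digraph C"
      and th: "tail C = fst" "head C = snd"
      using sub by (auto simp: subgraph_def compatible_def)
    have endsC: "arcs_ends C = arcs C" by (simp add: arcs_ends_conv th)
    obtain x0 where x0: "x0 \<in> verts C" using con by (auto simp: connected_conv)
    have "is_path ?A x0 [] x0" by (simp add: is_path_def)
    then obtain u p v where p: "is_path ?A u p v"
      and meets: "set (pawalk_verts u p) \<inter> verts C \<noteq> {}"
      and long: "\<And>u' p' v'. is_path ?A u' p' v' \<Longrightarrow> set (pawalk_verts u' p') \<inter> verts C \<noteq> {} \<Longrightarrow>
        length p' \<le> length p"
      by (rule longest_path[OF finA, where Q = "\<lambda>u p v. set (pawalk_verts u p) \<inter> verts C \<noteq> {}"])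
        (use x0 in auto)
    let ?W = "set (pawalk_verts u p)" and ?R = "set p \<union> (set p)\<inverse>"
    have pc: "pcas u p v" "distinct (pawalk_verts u p)" "set p \<subseteq> ?A"
      using p by (auto simp: is_path_def)
    have closed: "(x, y) \<in> ?R" if xy: "(x, y) \<in> ?A" "x \<in> ?W" for x y
    proof (rule maximal_path_closed[OF H p _ _ xy])
      show "y \<in> ?W" if "(v, y) \<in> ?A" for y
      proof (rule ccontr)
        assume "y \<notin> ?W"
        then have "is_path ?A u (p @ [(v, y)]) y" using p that by (intro is_path_snoc)
        moreover have "set (pawalk_verts u (p @ [(v, y)])) \<inter> verts C \<noteq> {}"
          using meets pc by (auto simp: pawalk_verts_snoc)
        ultimately have "length (p @ [(v, y)]) \<le> length p" by (rule long)
        then show False by simp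
      qed
      show "y \<in> ?W" if "(y, u) \<in> ?A" for y
      proof (rule ccontr)
        assume "y \<notin> ?W"
        then have "is_path ?A y ((y, u) # p) v" using p that by (simp add: is_path_def)
        moreover have "set (pawalk_verts y ((y, u) # p)) \<inter> verts C \<noteq> {}" using meets by auto
        ultimately have "length ((y, u) # p) \<le> length p" by (rule long)
        then show False by simp
      qed
    qed
    have RW: "x \<in> ?W \<and> y \<in> ?W" if "(x, y) \<in> ?R" for x y
    proof -
      have "{x, y} \<in> edges_of (set p)" using that by (simp only: doubleton_in_edges_of)
      then show ?thesis using edges_of_subset_verts[OF pc(1)] by blast
    qed
    have symC: "(y, z) \<in> ?A" if "(y, z) \<in> (arcs_ends C)\<^sup>s" for y z
      using that CA(2) symA unfolding endsC symcl_def by (auto dest: symD)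
    obtain w where w: "w \<in> ?W" "w \<in> verts C" using meets by blast
    \<comment> \<open>A walk in \<open>C\<close> that starts on the path cannot leave it.\<close>
    have CW: "verts C \<subseteq> ?W"
    proof
      fix y assume "y \<in> verts C"
      then have "(w, y) \<in> rtrancl_on (verts C) ((arcs_ends C)\<^sup>s)"
        using con w by (simp add: connected_conv)
      then show "y \<in> ?W"
      proof (induction rule: rtrancl_on_induct)
        case base
        show ?case by (rule w(1))
      next
        case (step y z)
        then show ?case using RW[OF closed[OF symC]] by blast
      qed
    qed
    let ?D = "with_proj \<lparr>pverts = ?W, parcs = ?R\<rparr>"
    have wfD: "wf_digraph ?D" unfolding wf_digraph_wp_iff
    proof unfold_locales
      fix e assume "e \<in> parcs \<lparr>pverts = ?W, parcs = ?R\<rparr>"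
      then have "(fst e, snd e) \<in> ?R" by simp
      then show "fst e \<in> pverts \<lparr>pverts = ?W, parcs = ?R\<rparr>" "snd e \<in> pverts \<lparr>pverts = ?W, parcs = ?R\<rparr>"
        using RW[of "fst e" "snd e"] by (simp_all only: pair_pre_digraph.simps)
    qed
    have "?D = C"
    proof (rule max)
      have "arcs C \<subseteq> ?R"
      proof
        fix a assume a: "a \<in> arcs C"
        then have "tail C a \<in> verts C" using wfC by (simp add: wf_digraph.tail_in_verts)
        then show "a \<in> ?R" using closed[of "fst a" "snd a"] CW CA a th by auto
      qed
      then show "subgraph C ?D"
        using CW wfC wfD th by (simp add: subgraph_def compatible_def)
      have "?W \<subseteq> V"
      proof (cases "p = []")
        case True
        then show ?thesis using w CA by auto
      next
        case False
        have "set (pawalk_verts u p) \<subseteq> insert u (snd ` set p)"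
          using pc(1) by (induction p arbitrary: u) auto
        moreover have "u \<in> V" using False pc AV by (cases p) auto
        moreover have "set p \<subseteq> V \<times> V" using pc(3) AV by (rule order_trans)
        then have "snd ` set p \<subseteq> V" by auto
        ultimately show ?thesis by blast
      qed
      moreover have "?R \<subseteq> ?A" using pc(3) symA by (auto dest: symD)
      ultimately show "subgraph ?D (with_proj F)"
        using wfD F.wf_digraph_axioms by (simp add: subgraph_def compatible_def)
      have reach: "(u, x) \<in> rtrancl_on ?W (?R\<^sup>s)" if "x \<in> ?W" for x
        using pc(1) that by (intro path_reachable[of u p v]) (auto simp: symcl_def)
      have "sym (?R\<^sup>s)" by (auto simp: symcl_def intro!: symI)
      then have "sym (rtrancl_on ?W (?R\<^sup>s))" by (rule rtrancl_on_sym)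
      then have "(x, y) \<in> rtrancl_on ?W (?R\<^sup>s)" if "x \<in> ?W" "y \<in> ?W" for x y
        using reach that by (meson rtrancl_on_trans symD)
      then show "Digraph_Component.connected ?D"
        unfolding connected_conv using w(1) by auto
    qed
    moreover have "path_graph ?D"
      unfolding path_graph_def
    proof (intro exI conjI)
      show "pre_digraph.apath ?D u p v"
        using pc start_in_pawalk_verts[OF pc(1)]
        by (simp add: pre_digraph.apath_def pre_digraph.awalk_def cas_with_proj_eq awalk_verts_with_proj_eq)
    qed (simp_all add: awalk_verts_with_proj_eq)
    ultimately show ?thesis by simp
  qed
  then show ?thesis using pg unfolding linear_forest_def F_def by blast
qed

section \<open>Assembling the \<open>k + 1\<close> linear forests\<close>

theorem theorem3:
  fixes G :: "'a pair_pre_digraph" and k :: nat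
  assumes "0 < k"
    and "pair_graph G"
    and "regular_graph (2 * k) G"
    and "enat (2 * k) \<le> girth G"
  shows "linear_arboricity G \<le> enat (k + 1)"
proof -
  interpret G: pair_graph G by (rule assms(2))
  let ?V = "pverts G"
  define E where "E = edges_of (parcs G)"
  have arcsE: "arcs_of E = parcs G"
  proof (intro set_eqI iffI)
    fix a assume "a \<in> arcs_of E"
    then show "a \<in> parcs G"
      using G.arcs_symmetric by (auto simp: arcs_of_def E_def doubleton_in_edges_of)
  qed (auto simp: arcs_of_def E_def edges_of_def)
  interpret edge_set E
  proof
    show "finite E" using G.pair_finite_arcs by (simp add: E_def edges_of_def)
    show "card e = 2" if "e \<in> E" for e
      using that G.pair_no_loops by (auto simp: E_def edges_of_def)
  qed
  have EV: "\<Union>E \<subseteq> ?V"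
    using G.wellformed' by (auto simp: E_def edges_of_def)
  have "deg E v = 2 * k" if v: "v \<in> ?V" for v
  proof -
    have "{e \<in> E. v \<in> e} = (\<lambda>a. {fst a, snd a}) ` out_arcs (with_proj G) v"
    proof (intro set_eqI iffI)
      fix e assume "e \<in> {e \<in> E. v \<in> e}"
      then obtain a b where "(a, b) \<in> parcs G" "e = {a, b}" "v = a \<or> v = b"
        by (auto simp: E_def edges_of_def)
      then obtain w where "(v, w) \<in> parcs G" "e = {v, w}"
        using G.arcs_symmetric by (auto simp: insert_commute)
      then show "e \<in> (\<lambda>a. {fst a, snd a}) ` out_arcs (with_proj G) v"
        by (intro image_eqI[of _ _ "(v, w)"]) (auto simp: out_arcs_def)
    qed (auto simp: E_def edges_of_def out_arcs_def)
    moreover have "inj_on (\<lambda>a. {fst a, snd a}) (out_arcs (with_proj G) v)"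
      by (auto simp: inj_on_def out_arcs_def doubleton_eq_iff)
    ultimately have "deg E v = out_degree (with_proj G) v"
      unfolding deg_def out_degree_def by (simp only: card_image)
    then show ?thesis using assms(3) v by (simp add: regular_graph_def)
  qed
  then obtain c where c: "\<And>e. e \<in> E \<Longrightarrow> c e < k" "\<And>i v. deg {e \<in> E. c e = i} v \<le> 2"
    using petersen_two_factors[OF G.pair_finite_verts EV] by blast
  let ?C = "\<lambda>i. {e \<in> E. c e = i}"
  \<comment> \<open>The cycles of the classes, as the minimal nonempty even sets inside a
    class.\<close>
  define \<Z> where "\<Z> = {Z. Z \<noteq> {} \<and> even_set Z \<and> (\<exists>i. Z \<subseteq> ?C i) \<and>
    (\<forall>Z'\<subseteq>Z. even_set Z' \<longrightarrow> Z' = {} \<or> Z' = Z)}"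
  \<comment> \<open>The class of a cycle, read off from an arbitrary edge, as all its edges have the
    same colour.\<close>
  define \<kappa> where "\<kappa> Z = c (SOME e. e \<in> Z)" for Z
  have \<Z>E: "\<Union>\<Z> \<subseteq> E" by (auto simp: \<Z>_def)
  have \<kappa>: "Z \<subseteq> ?C (\<kappa> Z)" "\<kappa> Z < k" if Z: "Z \<in> \<Z>" for Z
  proof -
    obtain i where "Z \<noteq> {}" "Z \<subseteq> ?C i" using Z by (auto simp: \<Z>_def)
    then have "(SOME e. e \<in> Z) \<in> ?C i" using some_in_eq by blast
    then have "\<kappa> Z = i" "i < k" using c(1) by (auto simp: \<kappa>_def)
    then show "Z \<subseteq> ?C (\<kappa> Z)" "\<kappa> Z < k" using \<open>Z \<subseteq> ?C i\<close> by simp_all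
  qed
  have "\<exists>\<sigma>\<subseteq>\<Union>\<Z>. path_forest \<sigma> \<and> (\<forall>Z\<in>\<Z>. \<sigma> \<inter> Z \<noteq> {})"
  proof (rule path_forest_transversal[where k = k and c = \<kappa>])
    show "finite \<Z>" using finite_E \<Z>E by (intro finite_subset[of \<Z> "Pow E"]) auto
    show "\<Union>\<Z> \<subseteq> E" by (rule \<Z>E)
    show "disjoint \<Z>"
    proof (rule disjointI)
      fix Z W assume ZW: "Z \<in> \<Z>" "W \<in> \<Z>" "Z \<noteq> W"
      show "Z \<inter> W = {}"
      proof (rule ccontr)
        assume "Z \<inter> W \<noteq> {}"
        then obtain e where e: "e \<in> Z" "e \<in> W" by blast
        then have "e \<in> ?C (\<kappa> Z)" "e \<in> ?C (\<kappa> W)" using \<kappa> ZW by blast+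
        then have "\<kappa> Z = \<kappa> W" by simp
        then have sub: "Z \<subseteq> ?C (\<kappa> Z)" "W \<subseteq> ?C (\<kappa> Z)" using \<kappa> ZW by metis+
        \<comment> \<open>Two cycles in the same class have an even intersection, because the class
          has maximal degree 2. If it is nonempty, minimality makes both cycles equal to it.\<close>
        have ev: "even_set (Z \<inter> W)"
          unfolding even_set_def
        proof
          fix v show "even (deg (Z \<inter> W) v)"
            using ZW c(2) finite_E
            by (intro even_deg_Int[OF _ sub]) (auto simp: \<Z>_def even_set_def)
        qed
        have minZ: "\<And>Z'. Z' \<subseteq> Z \<Longrightarrow> even_set Z' \<Longrightarrow> Z' = {} \<or> Z' = Z"
          and minW: "\<And>Z'. Z' \<subseteq> W \<Longrightarrow> even_set Z' \<Longrightarrow> Z' = {} \<or> Z' = W"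
          using ZW unfolding \<Z>_def by blast+
        have "Z \<inter> W = Z" using minZ[OF inf_le1 ev] \<open>Z \<inter> W \<noteq> {}\<close> by blast
        moreover have "Z \<inter> W = W" using minW[OF inf_le2 ev] \<open>Z \<inter> W \<noteq> {}\<close> by blast
        ultimately show False using ZW(3) by metis
      qed
    qed
    show "\<kappa> Z < k" if "Z \<in> \<Z>" for Z using \<kappa> that by blast
    show "2 * k \<le> card Z" if Z: "Z \<in> \<Z>" for Z
    proof (rule card_even_set_ge_girth[OF assms(2,4)])
      have ZE: "Z \<subseteq> E" using Z \<Z>E by blast
      then show "finite Z" by (rule finite_edges)
      show "arcs_of Z \<subseteq> parcs G" using ZE by (auto simp: arcsE[symmetric] arcs_of_def)
      show "card e = 2" if "e \<in> Z" for e using that ZE by (intro card_edge) blast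
      show "even_set Z" "Z \<noteq> {}" using Z by (auto simp: \<Z>_def)
      show "deg Z v \<le> 2" for v
        using deg_mono[of "?C (\<kappa> Z)" Z v] \<kappa>(1)[OF Z] c(2)[of "\<kappa> Z" v] finite_E by simp
    qed
    show "deg (\<Union>{Z \<in> \<Z>. \<kappa> Z = i}) v \<le> 2" for i v
    proof -
      have "\<Union>{Z \<in> \<Z>. \<kappa> Z = i} \<subseteq> ?C i" using \<kappa>(1) by blast
      then have "deg (\<Union>{Z \<in> \<Z>. \<kappa> Z = i}) v \<le> deg (?C i) v" using finite_E by (intro deg_mono) simp_all
      then show ?thesis using c(2)[of i v] by linarith
    qed
  qed
  then obtain \<sigma> where \<sigma>: "\<sigma> \<subseteq> \<Union>\<Z>" "path_forest \<sigma>" "\<And>Z. Z \<in> \<Z> \<Longrightarrow> \<sigma> \<inter> Z \<noteq> {}" by blast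
  have \<sigma>E: "\<sigma> \<subseteq> E" using \<sigma>(1) \<Z>E by blast
  \<comment> \<open>A nonempty even set left over in a class would contain a smallest one; that is a
    member of \<open>\<Z>\<close>, and these all meet \<open>\<sigma>\<close>.\<close>
  have pf: "path_forest (?C i - \<sigma>)" for i
    unfolding path_forest_def
  proof (intro conjI allI impI)
    show "deg (?C i - \<sigma>) v \<le> 2" for v
      using deg_mono[of "?C i" "?C i - \<sigma>" v] c(2)[of i v] finite_E by fastforce
    fix Y assume Y: "Y \<subseteq> ?C i - \<sigma>" "even_set Y"
    show "Y = {}"
    proof (rule ccontr)
      assume "Y \<noteq> {}"
      define P where "P Z \<longleftrightarrow> Z \<subseteq> ?C i - \<sigma> \<and> even_set Z \<and> Z \<noteq> {}" for Z
      have "P Y" using Y \<open>Y \<noteq> {}\<close> by (simp add: P_def)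
      then obtain Z where Z: "P Z" "\<forall>Z'. P Z' \<longrightarrow> card Z \<le> card Z'"
        using ex_has_least_nat[of P Y card] by blast
      have finZ: "finite Z" using Z(1) finite_E by (auto simp: P_def intro: finite_subset[of Z E])
      have "Z \<in> \<Z>"
        unfolding \<Z>_def
      proof (intro CollectI conjI allI impI)
        show "Z \<noteq> {}" "even_set Z" using Z(1) by (simp_all add: P_def)
        show "\<exists>i. Z \<subseteq> ?C i" using Z(1) by (intro exI[of _ i]) (auto simp: P_def)
        fix Z' assume Z': "Z' \<subseteq> Z" "even_set Z'"
        show "Z' = {} \<or> Z' = Z"
        proof (cases "Z' = {}")
          case False
          then have "P Z'" using Z' Z(1) by (auto simp: P_def)
          then have "card Z \<le> card Z'" using Z(2) by blast
          then show ?thesis using card_seteq[OF finZ Z'(1)] by simp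
        qed simp
      qed
      then have "\<sigma> \<inter> Z \<noteq> {}" by (rule \<sigma>(3))
      then show False using Z(1) by (auto simp: P_def)
    qed
  qed
  \<comment> \<open>Indices below \<open>k\<close> are the reduced classes; index \<open>k\<close>
    is \<open>\<sigma>\<close> itself.\<close>
  define H where "H i = (if i < k then ?C i - \<sigma> else \<sigma>)" for i
  have HE: "H i \<subseteq> E" for i using \<sigma>E by (auto simp: H_def)
  define F where "F i = \<lparr>pverts = ?V, parcs = arcs_of (H i)\<rparr>" for i
  have "linear_forest (F i)" for i
    unfolding F_def
  proof (rule linear_forest_of_path_forest)
    show "finite ?V" by (rule G.pair_finite_verts)
    show "\<Union>(H i) \<subseteq> ?V" using HE[of i] EV by blast
    show "finite (H i)" by (rule finite_edges[OF HE])
    show "path_forest (H i)" using pf \<sigma>(2) by (simp add: H_def)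
    show "card e = 2" if "e \<in> H i" for e using that HE by (intro card_edge) blast
  qed
  moreover have "subgraph (with_proj (F i)) (with_proj G)" for i
  proof -
    have sub: "arcs_of (H i) \<subseteq> parcs G" using HE by (auto simp: arcsE[symmetric] arcs_of_def)
    have "wf_digraph (with_proj (F i))"
      unfolding wf_digraph_wp_iff using sub G.wellformed' by unfold_locales (auto simp: F_def)
    then show ?thesis
      using sub G.wf_digraph_axioms by (simp add: subgraph_def compatible_def F_def)
  qed
  moreover have "disjoint_family_on (\<lambda>i. parcs (F i)) {..<k + 1}"
    by (auto simp: disjoint_family_on_def F_def arcs_of_def H_def split: if_splits)
  moreover have "(\<Union>i<k + 1. parcs (F i)) = parcs G"
  proof -
    have "(\<Union>i<k + 1. H i) = E"
    proof (intro equalityI subsetI)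
      fix e assume e: "e \<in> E"
      show "e \<in> (\<Union>i<k + 1. H i)"
      proof (cases "e \<in> \<sigma>")
        case True
        then show ?thesis by (intro UN_I[of k]) (auto simp: H_def)
      next
        case False
        then show ?thesis using e c(1)[OF e] by (intro UN_I[of "c e"]) (auto simp: H_def)
      qed
    qed (use HE in blast)
    moreover have "(\<Union>i<k + 1. parcs (F i)) = arcs_of (\<Union>i<k + 1. H i)"
      by (auto simp: F_def arcs_of_def)
    ultimately show ?thesis using arcsE by simp
  qed
  ultimately have "linear_forest_decomposition G (k + 1) F"
    unfolding linear_forest_decomposition_def by blast
  then show ?thesis
    unfolding linear_arboricity_def by (intro INF_lower) blast
qed

end
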